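(* Let $G$ and $G'$ be finite groups, and let $H,K\leq G$ and $H',K'\leq G'$ be subgroups such that $H\cong H'$, $G$ is the internal direct product of $H$ and $K$, and $G'$ is the internal direct product of $H'$ and $K'$. Suppose further that the multisets of degrees of the (complex) irreducible representations of $G$ and $G'$ are the same. Let $\sigma:H\to H'$ be an isomorphism. Then for each linear character $\chi$ of $H$, there exists a $(G,G')$-transformation matrix $U$ such that for all $h\in H$ and all $x\in G'$, we have $U_{h,x}=\delta_{x,\sigma(h)}\,\chi(h)$.
   Context: A matrix $U\in\mathbb{C}^{G\times G'}$ (rows indexed by $G$, columns by $G'$) is a $(G,G')$-transformation matrix if (1) $U$ is unitary; (2) $\overline{U_{a,b}}=U_{a^{-1},b^{-1}}$ for all $a\in G$, $b\in G'$; and (3) $U_{ab,c}=\sum_{x,y\in G',\,xy=c}U_{a,x}U_{b,y}$ for all $a,b\in G$, $c\in G'$. A linear character of a group is the character of a degree one complex representation, i.e. a homomorphism to $\mathbb{C}^\times$. *)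

theory Defs
  imports "Jordan_Normal_Form.VS_Connect" "HOL-Algebra.Algebra" "HOL-Library.Multiset"
begin

text \<open>A pair \<open>(n, \<rho>)\<close> is a complex matrix representation of degree \<open>n\<close>; only the values of \<open>\<rho>\<close>
  on the carrier matter.\<close>

definition representation ::
    "('a, 'c) monoid_scheme \<Rightarrow> nat \<times> ('a \<Rightarrow> complex mat) \<Rightarrow> bool" where
  "representation G = (\<lambda>(n, \<rho>). \<rho> \<in> hom G (units_of (ring_mat TYPE(complex) n ())))"

definition irreducible_representation ::
    "('a, 'c) monoid_scheme \<Rightarrow> nat \<times> ('a \<Rightarrow> complex mat) \<Rightarrow> bool" where
  "irreducible_representation G = (\<lambda>(n, \<rho>). representation G (n, \<rho>) \<and> n > 0 \<and>
     (\<forall>W. VectorSpace.subspace class_ring W (module_vec TYPE(complex) n) \<and>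
          (\<forall>g\<in>carrier G. \<forall>w\<in>W. \<rho> g *\<^sub>v w \<in> W) \<longrightarrow>
          W = {0\<^sub>v n} \<or> W = carrier_vec n))"

definition equivalent_representations ::
    "('a, 'c) monoid_scheme \<Rightarrow> nat \<times> ('a \<Rightarrow> complex mat) \<Rightarrow> nat \<times> ('a \<Rightarrow> complex mat) \<Rightarrow> bool" where
  "equivalent_representations G = (\<lambda>(n, \<rho>) (m, \<tau>). n = m \<and>
     (\<exists>P\<in>carrier_mat n n. invertible_mat P \<and> (\<forall>g\<in>carrier G. P * \<rho> g = \<tau> g * P)))"

definition irrep_classes ::
    "('a, 'c) monoid_scheme \<Rightarrow> (nat \<times> ('a \<Rightarrow> complex mat)) set set" where
  "irrep_classes G = {r. irreducible_representation G r} //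
     {(r, s). irreducible_representation G r \<and> irreducible_representation G s \<and>
              equivalent_representations G r s}"

text \<open>All members of a class have the same degree, so \<open>the_elem\<close> extracts it. For a finite
  group there are only finitely many classes, so \<open>mset_set\<close> does not degenerate.\<close>

definition irrep_degrees :: "('a, 'c) monoid_scheme \<Rightarrow> nat multiset" where
  "irrep_degrees G = image_mset (\<lambda>C. the_elem (fst ` C)) (mset_set (irrep_classes G))"

definition complex_mult_group :: "complex monoid" where
  "complex_mult_group = \<lparr>carrier = UNIV - {0}, monoid.mult = (*), one = 1\<rparr>"

definition linear_character :: "('a, 'c) monoid_scheme \<Rightarrow> ('a \<Rightarrow> complex) \<Rightarrow> bool" where
  "linear_character G \<chi> \<longleftrightarrow> \<chi> \<in> hom G complex_mult_group"

definition internal_direct_product ::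
    "('a, 'c) monoid_scheme \<Rightarrow> 'a set \<Rightarrow> 'a set \<Rightarrow> bool" where
  "internal_direct_product G H K \<longleftrightarrow>
     H \<lhd> G \<and> K \<lhd> G \<and> H <#>\<^bsub>G\<^esub> K = carrier G \<and> H \<inter> K = {\<one>\<^bsub>G\<^esub>}"

text \<open>Matrices with rows indexed by \<open>I\<close> and columns by \<open>J\<close> are functions, of which only the
  values on \<open>I \<times> J\<close> matter. As \<open>I\<close> and \<open>J\<close> may differ, unitarity demands both \<open>U U\<^sup>* = 1\<close>
  and \<open>U\<^sup>* U = 1\<close>.\<close>

definition unitary_on :: "'a set \<Rightarrow> 'b set \<Rightarrow> ('a \<Rightarrow> 'b \<Rightarrow> complex) \<Rightarrow> bool" where
  "unitary_on I J U \<longleftrightarrow>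
     (\<forall>a\<in>I. \<forall>b\<in>I. (\<Sum>x\<in>J. U a x * cnj (U b x)) = (if a = b then 1 else 0)) \<and>
     (\<forall>x\<in>J. \<forall>y\<in>J. (\<Sum>a\<in>I. cnj (U a x) * U a y) = (if x = y then 1 else 0))"

definition transformation_matrix ::
    "('a, 'c) monoid_scheme \<Rightarrow> ('b, 'd) monoid_scheme \<Rightarrow> ('a \<Rightarrow> 'b \<Rightarrow> complex) \<Rightarrow> bool" where
  "transformation_matrix G G' U \<longleftrightarrow>
     unitary_on (carrier G) (carrier G') U \<and>
     (\<forall>a\<in>carrier G. \<forall>b\<in>carrier G'. cnj (U a b) = U (inv\<^bsub>G\<^esub> a) (inv\<^bsub>G'\<^esub> b)) \<and>
     (\<forall>a\<in>carrier G. \<forall>b\<in>carrier G. \<forall>c\<in>carrier G'.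
        U (a \<otimes>\<^bsub>G\<^esub> b) c =
        (\<Sum>(x, y)\<in>{(x, y). x \<in> carrier G' \<and> y \<in> carrier G' \<and> x \<otimes>\<^bsub>G'\<^esub> y = c}. U a x * U b y))"

end

theory Submission
  imports Defs "Jordan_Normal_Form.Spectral_Radius"
begin

text \<open>A unitary isomorphism of group algebras with involution is exactly a transformation matrix.
  Since the degrees of \<open>H \<times> K\<close> are the products of the degrees of \<open>H\<close> and of \<open>K\<close>, and a nonempty
  multiset of positive integers can be cancelled from such a product, \<open>K\<close> and \<open>K'\<close> have the
  same degrees. Matching the irreducible unitary representations of \<open>K\<close> and \<open>K'\<close> then identifies
  the orthonormal bases of matrix coefficients and yields a transformation matrix \<open>V\<close> for
  \<open>(K, K')\<close>; the required matrix is the tensor product of \<open>V\<close> with the monomial matrix of \<open>\<chi>\<close> and \<open>\<sigma>\<close>.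

  Irreducibility never enters the construction of representations: a complete system is a family of
  unitary matrix representations satisfying the Schur orthogonality relations whose squared degrees
  add up to the group order. To extend an incomplete system, take a representation of least degree
  having a matrix coefficient outside the span of the given ones; minimality forces its commutant
  to be scalar, and Schur orthogonality follows.\<close>

section \<open>Orthonormal families of functions on a finite set\<close>

text \<open>Conditions (2) and (3) say that sending \<open>a\<close> to row \<open>a\<close> is a
  homomorphism into the group algebra of G' compatible with its involution, hence the insistence on
  unitary representations. The passage to K and K' is forced by the prescribed rows: an arbitrary
  matching of the representations of G and G' says nothing about where H goes, whereas in a tensor
  product the rows over H involve only the identity row of V. That row is a delta because matched
  representations take the same value, the identity matrix, at the identity element.

  The given data speak only of G and G', and of classes under arbitrary invertible changes of basis.
  So a complete system must first be shown to meet every class exactly once and to be stable under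
  products; only then does the hypothesis say anything about K. Completeness is detected by counting
  throughout: an orthonormal family with as many members as there are points is a basis. Cancelling
  the degrees of H rests on comparing largest elements.\<close>

definition inner_on :: "'s set \<Rightarrow> ('s \<Rightarrow> complex) \<Rightarrow> ('s \<Rightarrow> complex) \<Rightarrow> complex" where
  "inner_on S f g = (\<Sum>x\<in>S. f x * cnj (g x))"

definition orthonormal_on :: "'s set \<Rightarrow> 't set \<Rightarrow> ('t \<Rightarrow> 's \<Rightarrow> complex) \<Rightarrow> bool" where
  "orthonormal_on S T u \<longleftrightarrow> (\<forall>k\<in>T. \<forall>l\<in>T. inner_on S (u k) (u l) = (if k = l then 1 else 0))"

text \<open>The matrix of the orthogonal projection onto the span of the family. It lets dimension
  counts be made as traces.\<close>

definition projection_kernel :: "'t set \<Rightarrow> ('t \<Rightarrow> 's \<Rightarrow> complex) \<Rightarrow> 's \<Rightarrow> 's \<Rightarrow> complex" where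
  "projection_kernel T u x y = (\<Sum>k\<in>T. u k x * cnj (u k y))"

lemma inner_on_commute: "inner_on S g f = cnj (inner_on S f g)"
  by (simp add: inner_on_def mult.commute)

lemma inner_on_add_left: "inner_on S (\<lambda>x. f x + g x) h = inner_on S f h + inner_on S g h"
  by (simp add: inner_on_def sum.distrib algebra_simps)

lemma inner_on_diff_left: "inner_on S (\<lambda>x. f x - g x) h = inner_on S f h - inner_on S g h"
  by (simp add: inner_on_def sum_subtractf algebra_simps)

lemma inner_on_diff_right: "inner_on S h (\<lambda>x. f x - g x) = inner_on S h f - inner_on S h g"
  by (simp add: inner_on_def sum_subtractf algebra_simps)

lemma inner_on_scale_left: "inner_on S (\<lambda>x. c * f x) h = c * inner_on S f h"
  by (simp add: inner_on_def sum_distrib_left mult.assoc)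

lemma inner_on_scale_right: "inner_on S f (\<lambda>x. c * h x) = cnj c * inner_on S f h"
  by (simp add: inner_on_def sum_distrib_left mult_ac)

lemma inner_on_sum_left: "inner_on S (\<lambda>x. \<Sum>k\<in>T. c k * f k x) h = (\<Sum>k\<in>T. c k * inner_on S (f k) h)"
  unfolding inner_on_def sum_distrib_left sum_distrib_right
  by (subst sum.swap) (simp add: mult.assoc)

lemma inner_on_sum_right:
  "inner_on S h (\<lambda>x. \<Sum>k\<in>T. c k * f k x) = (\<Sum>k\<in>T. cnj (c k) * inner_on S h (f k))"
  by (subst inner_on_commute, subst inner_on_sum_left) (simp add: inner_on_commute[of S h])

lemma inner_on_cong:
  "(\<And>x. x \<in> S \<Longrightarrow> f x = f' x) \<Longrightarrow> (\<And>x. x \<in> S \<Longrightarrow> g x = g' x) \<Longrightarrow> inner_on S f g = inner_on S f' g'"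
  by (simp add: inner_on_def)

lemma inner_on_self: "inner_on S f f = complex_of_real (\<Sum>x\<in>S. (cmod (f x))\<^sup>2)"
  by (simp add: inner_on_def complex_norm_square[symmetric])

lemma inner_on_self_eq_0:
  assumes "finite S"
  shows "inner_on S f f = 0 \<longleftrightarrow> (\<forall>x\<in>S. f x = 0)"
proof -
  have "inner_on S f f = 0 \<longleftrightarrow> (\<Sum>x\<in>S. (cmod (f x))\<^sup>2) = 0"
    unfolding inner_on_self of_real_eq_0_iff ..
  also have "\<dots> \<longleftrightarrow> (\<forall>x\<in>S. f x = 0)"
    by (subst sum_nonneg_eq_0_iff) (use assms in auto)
  finally show ?thesis .
qed

lemma inner_on_kronecker:
  "finite S \<Longrightarrow> x \<in> S \<Longrightarrow> inner_on S (\<lambda>y. if x = y then 1 else 0) f = cnj (f x)"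
  by (simp add: inner_on_def if_distrib[of "\<lambda>z. z * _"] cong: if_cong)

text \<open>Row \<open>x\<close> of the kernel is the orthogonal projection of the indicator of
  \<open>x\<close> onto the span of the conjugated family, so Pythagoras gives the squared length of
  what remains.\<close>

lemma projection_kernel_residual:
  assumes "finite S" "finite T" "orthonormal_on S T u" "x \<in> S"
  defines "w \<equiv> \<lambda>y. (if x = y then 1 else 0) - projection_kernel T u x y"
  shows "inner_on S w w = 1 - projection_kernel T u x x"
proof -
  let ?e = "\<lambda>y. if x = y then 1 else 0 :: complex"
  let ?p = "projection_kernel T u x"
  have p: "?p = (\<lambda>y. \<Sum>k\<in>T. u k x * cnj (u k y))"
    by (simp add: projection_kernel_def fun_eq_iff)
  have real: "cnj (?p x) = ?p x"
    by (simp add: projection_kernel_def mult.commute)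
  have on: "inner_on S (\<lambda>y. cnj (u k y)) (\<lambda>y. cnj (u l y)) = (if k = l then 1 else 0)"
    if "k \<in> T" "l \<in> T" for k l
  proof -
    have "inner_on S (\<lambda>y. cnj (u k y)) (\<lambda>y. cnj (u l y)) = inner_on S (u l) (u k)"
      by (simp add: inner_on_def mult.commute)
    then show ?thesis
      using assms(3) that by (auto simp: orthonormal_on_def)
  qed
  have "inner_on S ?p ?p = (\<Sum>k\<in>T. u k x * (\<Sum>l\<in>T. cnj (u l x) * (if k = l then 1 else 0)))"
    unfolding p by (simp add: inner_on_sum_left inner_on_sum_right on cong: sum.cong)
  also have "\<dots> = ?p x"
    by (simp add: projection_kernel_def if_distrib[of "\<lambda>z. _ * z"] \<open>finite T\<close> cong: if_cong)
  finally have pp: "inner_on S ?p ?p = ?p x" .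
  have ep: "inner_on S ?e ?p = ?p x" and ee: "inner_on S ?e ?e = 1"
    using inner_on_kronecker[OF \<open>finite S\<close> \<open>x \<in> S\<close>, of ?p]
      inner_on_kronecker[OF \<open>finite S\<close> \<open>x \<in> S\<close>, of ?e] real by simp_all
  have pe: "inner_on S ?p ?e = ?p x"
    by (subst inner_on_commute) (simp add: ep real)
  show ?thesis
    unfolding w_def by (simp add: inner_on_diff_left inner_on_diff_right pp ep ee pe)
qed

lemma projection_kernel_trace:
  assumes "orthonormal_on S T u"
  shows "(\<Sum>x\<in>S. projection_kernel T u x x) = of_nat (card T)"
proof -
  have "(\<Sum>x\<in>S. projection_kernel T u x x) = (\<Sum>k\<in>T. inner_on S (u k) (u k))"
    unfolding projection_kernel_def inner_on_def by (rule sum.swap)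
  also have "\<dots> = of_nat (card T)"
    using assms by (simp add: orthonormal_on_def)
  finally show ?thesis .
qed

text \<open>For a projection P, the squared Frobenius norm of 1 - P is its trace. This one identity
  gives both the bound on the size of an orthonormal family, by nonnegativity, and completeness in
  the case of equality.\<close>

lemma orthonormal_on_defect:
  fixes u :: "'t \<Rightarrow> 's \<Rightarrow> complex"
  assumes "finite S" "finite T" "orthonormal_on S T u"
  shows "(\<Sum>x\<in>S. \<Sum>y\<in>S. (cmod ((if x = y then 1 else 0) - projection_kernel T u x y))\<^sup>2)
    = real (card S) - real (card T)"
proof -
  let ?w = "\<lambda>x y. (if x = y then 1 else 0) - projection_kernel T u x y"
  have "complex_of_real (\<Sum>x\<in>S. \<Sum>y\<in>S. (cmod (?w x y))\<^sup>2) = (\<Sum>x\<in>S. inner_on S (?w x) (?w x))"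
    by (simp add: inner_on_self)
  also have "\<dots> = (\<Sum>x\<in>S. 1 - projection_kernel T u x x)"
    by (intro sum.cong refl projection_kernel_residual assms)
  also have "\<dots> = complex_of_real (real (card S) - real (card T))"
    by (simp add: sum_subtractf projection_kernel_trace[OF assms(3)])
  finally show ?thesis
    unfolding of_real_eq_iff .
qed

lemma orthonormal_on_card_le:
  assumes "finite S" "finite T" "orthonormal_on S T u"
  shows "card T \<le> card S"
proof -
  have "0 \<le> real (card S) - real (card T)"
    unfolding orthonormal_on_defect[OF assms, symmetric] by (intro sum_nonneg) simp
  then show ?thesis by simp
qed

lemma orthonormal_on_complete:
  assumes "finite S" "finite T" "orthonormal_on S T u" "card T = card S" "x \<in> S" "y \<in> S"
  shows "projection_kernel T u x y = (if x = y then 1 else 0)"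
proof -
  let ?w = "\<lambda>x y. (if x = y then 1 else 0) - projection_kernel T u x y"
  have "(\<Sum>x\<in>S. \<Sum>y\<in>S. (cmod (?w x y))\<^sup>2) = 0"
    using orthonormal_on_defect[OF assms(1-3)] assms(4) by simp
  then have "(\<Sum>y\<in>S. (cmod (?w x y))\<^sup>2) = 0"
    using assms(1,5) by (subst (asm) sum_nonneg_eq_0_iff) (auto intro: sum_nonneg)
  then have "(cmod (?w x y))\<^sup>2 = 0"
    using assms(1,6) by (subst (asm) sum_nonneg_eq_0_iff) auto
  then show ?thesis by simp
qed

lemma orthonormal_on_complete_card:
  assumes "finite S" "finite T" "orthonormal_on S T u"
    and "\<And>x y. x \<in> S \<Longrightarrow> y \<in> S \<Longrightarrow> projection_kernel T u x y = (if x = y then 1 else 0)"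
  shows "card T = card S"
  using orthonormal_on_defect[OF assms(1-3)] assms(4) by simp

section \<open>Subspaces of functions, orthonormal bases and orthogonal complements\<close>

definition linear_subspace :: "('s \<Rightarrow> complex) set \<Rightarrow> bool" where
  "linear_subspace V \<longleftrightarrow> (\<lambda>x. 0) \<in> V \<and> (\<forall>f\<in>V. \<forall>g\<in>V. \<forall>c. (\<lambda>x. f x + c * g x) \<in> V)"

lemma linear_subspace_zero: "linear_subspace V \<Longrightarrow> (\<lambda>x. 0) \<in> V"
  by (simp add: linear_subspace_def)

lemma linear_subspace_add_scale:
  "linear_subspace V \<Longrightarrow> f \<in> V \<Longrightarrow> g \<in> V \<Longrightarrow> (\<lambda>x. f x + c * g x) \<in> V"
  by (simp add: linear_subspace_def)

lemma linear_subspace_sum: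
  assumes "linear_subspace V" "finite T" "\<And>k. k \<in> T \<Longrightarrow> f k \<in> V"
  shows "(\<lambda>x. \<Sum>k\<in>T. c k * f k x) \<in> V"
  using assms(2,3)
proof (induction T rule: finite_induct)
  case empty
  then show ?case using assms(1) by (simp add: linear_subspace_def)
next
  case (insert k T)
  then have "(\<lambda>x. \<Sum>k\<in>T. c k * f k x) \<in> V" "f k \<in> V" by auto
  then have "(\<lambda>x. (\<Sum>k\<in>T. c k * f k x) + c k * f k x) \<in> V"
    using assms(1) by (auto simp: linear_subspace_def)
  then show ?case
    using insert.hyps by (simp add: add.commute)
qed

text \<open>An orthonormal family in \<open>V\<close> of greatest length exists because lengths are
  bounded by \<open>card S\<close>. If some \<open>f\<close> in \<open>V\<close> differed on
  \<open>S\<close> from its expansion, the normalised remainder could be appended. The expansion is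
  claimed on \<open>S\<close> only, since values elsewhere are arbitrary.\<close>

lemma ex_orthonormal_basis:
  assumes "finite S" "linear_subspace V"
  obtains m and u :: "nat \<Rightarrow> 's \<Rightarrow> complex" where
    "orthonormal_on S {..<m} u" "\<And>k. k < m \<Longrightarrow> u k \<in> V"
    "\<And>f x. f \<in> V \<Longrightarrow> x \<in> S \<Longrightarrow> f x = (\<Sum>k<m. inner_on S f (u k) * u k x)"
proof -
  let ?P = "\<lambda>m. \<exists>u :: nat \<Rightarrow> 's \<Rightarrow> complex. orthonormal_on S {..<m} u \<and> (\<forall>k<m. u k \<in> V)"
  have "?P 0" by (simp add: orthonormal_on_def)
  moreover have "\<forall>m. ?P m \<longrightarrow> m < Suc (card S)"
    using orthonormal_on_card_le[OF assms(1) finite_lessThan] by (metis card_lessThan less_Suc_eq_le)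
  ultimately have "\<exists>m. ?P m \<and> (\<forall>m'. ?P m' \<longrightarrow> m' \<le> m)"
    by (rule ex_has_greatest_nat)
  then obtain m where m: "?P m" and max: "\<And>m'. ?P m' \<Longrightarrow> m' \<le> m" by blast
  then obtain u where u: "orthonormal_on S {..<m} u" and uV: "\<And>k. k < m \<Longrightarrow> u k \<in> V" by auto
  have "f x = (\<Sum>k<m. inner_on S f (u k) * u k x)" if f: "f \<in> V" and x: "x \<in> S" for f x
  proof (rule ccontr)
    assume ne: "f x \<noteq> (\<Sum>k<m. inner_on S f (u k) * u k x)"
    define s where "s = (\<lambda>x. \<Sum>k<m. inner_on S f (u k) * u k x)"
    define w where "w = (\<lambda>x. f x - s x)"
    have "s \<in> V"
      unfolding s_def using uV by (intro linear_subspace_sum assms) auto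
    then have wV: "w \<in> V"
      using linear_subspace_add_scale[OF assms(2) f, of s "-1"] by (simp add: w_def)
    have wu: "inner_on S w (u l) = 0" if "l < m" for l
    proof -
      have "inner_on S s (u l) = (\<Sum>k<m. inner_on S f (u k) * (if k = l then 1 else 0))"
        unfolding s_def inner_on_sum_left using u that by (simp add: orthonormal_on_def)
      also have "\<dots> = inner_on S f (u l)"
        using that by (simp add: if_distrib[of "\<lambda>z. _ * z"] cong: if_cong)
      finally show ?thesis by (simp add: w_def inner_on_diff_left)
    qed
    define N where "N = (\<Sum>x\<in>S. (cmod (w x))\<^sup>2)"
    have ww: "inner_on S w w = complex_of_real N" by (simp add: N_def inner_on_self)
    have "w x \<noteq> 0" using ne by (simp add: w_def s_def)
    then have "N \<noteq> 0"
      using inner_on_self_eq_0[OF assms(1), of w] x by (auto simp: ww)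
    moreover have "N \<ge> 0" by (simp add: N_def sum_nonneg)
    ultimately have N: "N > 0" by simp
    define c where "c = complex_of_real (1 / sqrt N)"
    define v where "v = (\<lambda>x. c * w x)"
    have vV: "v \<in> V"
      using linear_subspace_add_scale[OF assms(2) linear_subspace_zero[OF assms(2)] wV, of c]
      by (simp add: v_def)
    have vv: "inner_on S v v = 1"
    proof -
      have "c * cnj c = 1 / complex_of_real N"
        using N by (simp add: c_def flip: of_real_mult)
      then have "c * cnj c * complex_of_real N = 1"
        using N by simp
      moreover have "inner_on S v v = c * cnj c * complex_of_real N"
        unfolding v_def by (simp add: inner_on_scale_left inner_on_scale_right ww)
      ultimately show ?thesis by simp
    qed
    have vu: "inner_on S v (u l) = 0" if "l < m" for l
      using wu[OF that] by (simp add: v_def inner_on_scale_left)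
    have uv: "inner_on S (u l) v = 0" if "l < m" for l
      using vu[OF that] by (subst inner_on_commute) simp
    have "orthonormal_on S {..<Suc m} (u(m := v))"
      using u by (auto simp: orthonormal_on_def less_Suc_eq vv vu uv)
    moreover have "\<forall>k<Suc m. (u(m := v)) k \<in> V"
      using uV vV by (simp add: less_Suc_eq)
    ultimately have "Suc m \<le> m" using max by blast
    then show False by simp
  qed
  with u uV show ?thesis using that by blast
qed

lemma orthonormal_on_expansion:
  assumes "finite S" "finite T" "orthonormal_on S T u" "card T = card S" "x \<in> S"
  shows "f x = (\<Sum>k\<in>T. inner_on S f (u k) * u k x)"
proof -
  have "(\<Sum>k\<in>T. inner_on S f (u k) * u k x) = (\<Sum>y\<in>S. f y * projection_kernel T u x y)"
    unfolding inner_on_def projection_kernel_def sum_distrib_left sum_distrib_right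
    by (subst sum.swap) (simp add: mult_ac)
  also have "\<dots> = (\<Sum>y\<in>S. if x = y then f y else 0)"
    using orthonormal_on_complete[OF assms(1-4)] assms(5) by (intro sum.cong) auto
  also have "\<dots> = f x" using assms(1,5) by simp
  finally show ?thesis ..
qed

text \<open>For an orthonormal family this is its span up to values off \<open>S\<close>, described
  as the fixed space of the projection: membership is an equation, with no coefficients to
  exhibit.\<close>

definition reproduced :: "'s set \<Rightarrow> 't set \<Rightarrow> ('t \<Rightarrow> 's \<Rightarrow> complex) \<Rightarrow> ('s \<Rightarrow> complex) set" where
  "reproduced S T u = {f. \<forall>x\<in>S. (\<Sum>y\<in>S. projection_kernel T u x y * f y) = f x}"

lemma linear_subspace_reproduced: "linear_subspace (reproduced S T u)"
  unfolding linear_subspace_def reproduced_def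
  by (auto simp: algebra_simps sum.distrib simp flip: sum_distrib_left)

lemma reproduced_cong: "f \<in> reproduced S T u \<Longrightarrow> (\<And>x. x \<in> S \<Longrightarrow> f x = g x) \<Longrightarrow> g \<in> reproduced S T u"
  by (simp add: reproduced_def)

lemma reproduced_member:
  assumes "finite T" "orthonormal_on S T u" "k \<in> T"
  shows "u k \<in> reproduced S T u"
proof -
  have "(\<Sum>y\<in>S. projection_kernel T u x y * u k y) = (\<Sum>l\<in>T. u l x * inner_on S (u k) (u l))" for x
    unfolding inner_on_def projection_kernel_def sum_distrib_left sum_distrib_right
    by (subst sum.swap) (simp add: mult_ac)
  also have "\<dots> x = u k x" for x
  proof -
    have "(\<Sum>l\<in>T. u l x * inner_on S (u k) (u l)) = (\<Sum>l\<in>T. if k = l then u l x else 0)"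
      using assms(2,3) by (intro sum.cong) (auto simp: orthonormal_on_def)
    then show ?thesis using assms(1,3) by simp
  qed
  finally show ?thesis by (simp add: reproduced_def)
qed

text \<open>Reproducing the indicator of \<open>y\<close> means that column \<open>y\<close> of the
  kernel is that of the identity matrix.\<close>

lemma reproduced_kronecker_card:
  assumes "finite S" "finite T" "orthonormal_on S T u"
    and "\<And>y. y \<in> S \<Longrightarrow> (\<lambda>x. if x = y then 1 else 0) \<in> reproduced S T u"
  shows "card T = card S"
proof (rule orthonormal_on_complete_card[OF assms(1-3)])
  fix x y assume xy: "x \<in> S" "y \<in> S"
  have "(\<Sum>z\<in>S. projection_kernel T u x z * (if z = y then 1 else 0)) = (if x = y then 1 else 0)"
    using assms(4)[OF xy(2)] xy(1) by (simp add: reproduced_def)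
  then show "projection_kernel T u x y = (if x = y then 1 else 0)"
    using xy(2) assms(1) by (simp add: if_distrib[of "\<lambda>z. _ * z"] cong: if_cong)
qed

definition orthogonal_complement :: "'s set \<Rightarrow> ('s \<Rightarrow> complex) set \<Rightarrow> ('s \<Rightarrow> complex) set" where
  "orthogonal_complement S V = {f. \<forall>v\<in>V. inner_on S f v = 0}"

lemma linear_subspace_orthogonal_complement: "linear_subspace (orthogonal_complement S V)"
  by (auto simp: linear_subspace_def orthogonal_complement_def inner_on_add_left inner_on_scale_left)
    (simp add: inner_on_def)

text \<open>Subtracting the projection onto \<open>V\<close> leaves a function in the complement.
  Its coefficients along \<open>w\<close> are those of \<open>f\<close> itself, because the
  subtracted part is orthogonal to every \<open>w k\<close>.\<close>

lemma orthogonal_decomposition: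
  fixes m m' :: nat
  assumes "finite S" "linear_subspace V"
    and u: "orthonormal_on S {..<m} u" "\<And>k. k < m \<Longrightarrow> u k \<in> V"
      "\<And>f x. f \<in> V \<Longrightarrow> x \<in> S \<Longrightarrow> f x = (\<Sum>k<m. inner_on S f (u k) * u k x)"
    and w: "\<And>k. k < m' \<Longrightarrow> w k \<in> orthogonal_complement S V"
      "\<And>f x. f \<in> orthogonal_complement S V \<Longrightarrow> x \<in> S \<Longrightarrow> f x = (\<Sum>k<m'. inner_on S f (w k) * w k x)"
    and x: "x \<in> S"
  shows "f x = (\<Sum>k<m. inner_on S f (u k) * u k x) + (\<Sum>k<m'. inner_on S f (w k) * w k x)"
proof -
  define s where "s = (\<lambda>x. \<Sum>k<m. inner_on S f (u k) * u k x)"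
  define t where "t = (\<lambda>x. f x - s x)"
  have sV: "s \<in> V"
    unfolding s_def using u(2) by (intro linear_subspace_sum assms(2)) auto
  have tu: "inner_on S t (u l) = 0" if "l < m" for l
  proof -
    have "inner_on S s (u l) = (\<Sum>k<m. inner_on S f (u k) * (if k = l then 1 else 0))"
      unfolding s_def inner_on_sum_left using u(1) that by (simp add: orthonormal_on_def)
    also have "\<dots> = inner_on S f (u l)"
      using that by (simp add: if_distrib[of "\<lambda>z. _ * z"] cong: if_cong)
    finally show ?thesis by (simp add: t_def inner_on_diff_left)
  qed
  have tv: "inner_on S t v = 0" if "v \<in> V" for v
  proof -
    have "inner_on S t v = inner_on S t (\<lambda>x. \<Sum>k<m. inner_on S v (u k) * u k x)"
      by (rule inner_on_cong) (use u(3)[OF that] in auto)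
    also have "\<dots> = 0"
      unfolding inner_on_sum_right by (simp add: tu)
    finally show ?thesis .
  qed
  then have "t \<in> orthogonal_complement S V" by (simp add: orthogonal_complement_def)
  then have "t x = (\<Sum>k<m'. inner_on S t (w k) * w k x)" using w(2) x by blast
  also have "\<dots> = (\<Sum>k<m'. inner_on S f (w k) * w k x)"
  proof (intro sum.cong refl)
    fix k assume "k \<in> {..<m'}"
    then have "inner_on S (w k) s = 0" using w(1) sV by (simp add: orthogonal_complement_def)
    then have "inner_on S s (w k) = 0" by (subst inner_on_commute) simp
    then show "inner_on S t (w k) * w k x = inner_on S f (w k) * w k x"
      by (simp add: t_def inner_on_diff_left)
  qed
  finally show ?thesis by (simp add: t_def s_def algebra_simps)
qed

text \<open>Algebraic closedness of the complex numbers enters here; it is what makes commutants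
  scalar later.\<close>

lemma ex_eigenvector:
  fixes A :: "nat \<Rightarrow> nat \<Rightarrow> complex"
  assumes "n > 0"
  obtains ev v where "\<exists>a<n. v a \<noteq> 0" "\<And>a. a < n \<Longrightarrow> (\<Sum>b<n. A a b * v b) = ev * v a"
proof -
  define M where "M = mat n n (\<lambda>(i, j). A i j)"
  have M: "M \<in> carrier_mat n n" by (simp add: M_def)
  from spectrum_non_empty[OF M assms] obtain ev where "eigenvalue M ev"
    by (auto simp: spectrum_def)
  then obtain v where v: "v \<in> carrier_vec n" "v \<noteq> 0\<^sub>v n" "M *\<^sub>v v = ev \<cdot>\<^sub>v v"
    using M by (auto simp: eigenvalue_def eigenvector_def)
  have "\<exists>a<n. v $ a \<noteq> 0"
  proof (rule ccontr)
    assume "\<not> ?thesis"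
    then have "v = 0\<^sub>v n" using v(1) by (intro eq_vecI) auto
    then show False using v(2) by simp
  qed
  moreover have "(\<Sum>b<n. A a b * v $ b) = ev * v $ a" if "a < n" for a
  proof -
    have "(M *\<^sub>v v) $ a = (\<Sum>b<n. A a b * v $ b)"
      using that v(1) by (simp add: M_def scalar_prod_def atLeast0LessThan)
    then show ?thesis using v that by simp
  qed
  ultimately show ?thesis using that[of "\<lambda>a. v $ a" ev] by blast
qed

section \<open>Unitary matrix representations\<close>

text \<open>The index set is an arbitrary finite set, so that the regular representation can be
  indexed by the group and tensor products by pairs. Unitarity is written as a rule for inverses,
  the form in which it yields condition (2) of a transformation matrix.\<close>

definition unitary_rep :: "('a, 'c) monoid_scheme \<Rightarrow> 'k set \<Rightarrow> ('a \<Rightarrow> 'k \<Rightarrow> 'k \<Rightarrow> complex) \<Rightarrow> bool" where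
  "unitary_rep G S r \<longleftrightarrow> finite S \<and>
     (\<forall>g\<in>carrier G. \<forall>h\<in>carrier G. \<forall>a\<in>S. \<forall>b\<in>S. r (g \<otimes>\<^bsub>G\<^esub> h) a b = (\<Sum>c\<in>S. r g a c * r h c b)) \<and>
     (\<forall>a\<in>S. \<forall>b\<in>S. r \<one>\<^bsub>G\<^esub> a b = (if a = b then 1 else 0)) \<and>
     (\<forall>g\<in>carrier G. \<forall>a\<in>S. \<forall>b\<in>S. r (inv\<^bsub>G\<^esub> g) a b = cnj (r g b a))"

lemma unitary_repD:
  assumes "unitary_rep G S r"
  shows "finite S"
    and "\<And>g h a b. g \<in> carrier G \<Longrightarrow> h \<in> carrier G \<Longrightarrow> a \<in> S \<Longrightarrow> b \<in> S \<Longrightarrow>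
      r (g \<otimes>\<^bsub>G\<^esub> h) a b = (\<Sum>c\<in>S. r g a c * r h c b)"
    and "\<And>a b. a \<in> S \<Longrightarrow> b \<in> S \<Longrightarrow> r \<one>\<^bsub>G\<^esub> a b = (if a = b then 1 else 0)"
    and "\<And>g a b. g \<in> carrier G \<Longrightarrow> a \<in> S \<Longrightarrow> b \<in> S \<Longrightarrow> r (inv\<^bsub>G\<^esub> g) a b = cnj (r g b a)"
  using assms by (auto simp: unitary_rep_def)

definition rep_action :: "'k set \<Rightarrow> ('a \<Rightarrow> 'k \<Rightarrow> 'k \<Rightarrow> complex) \<Rightarrow> 'a \<Rightarrow> ('k \<Rightarrow> complex) \<Rightarrow> 'k \<Rightarrow> complex" where
  "rep_action S r g f a = (\<Sum>b\<in>S. r g a b * f b)"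

lemma rep_action_cong: "(\<And>b. b \<in> S \<Longrightarrow> f b = f' b) \<Longrightarrow> rep_action S r g f = rep_action S r g f'"
  by (simp add: rep_action_def fun_eq_iff)

lemma rep_action_sum:
  "rep_action S r g (\<lambda>b. \<Sum>k\<in>T. c k * f k b) a = (\<Sum>k\<in>T. c k * rep_action S r g (f k) a)"
  unfolding rep_action_def sum_distrib_left by (subst sum.swap) (simp add: mult_ac)

lemma rep_action_mult:
  assumes "unitary_rep G S r" "g \<in> carrier G" "h \<in> carrier G" "a \<in> S"
  shows "rep_action S r (g \<otimes>\<^bsub>G\<^esub> h) f a = rep_action S r g (rep_action S r h f) a"
proof -
  have "rep_action S r (g \<otimes>\<^bsub>G\<^esub> h) f a = (\<Sum>b\<in>S. \<Sum>c\<in>S. r g a c * r h c b * f b)"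
    unfolding rep_action_def using unitary_repD(2)[OF assms(1-3)] assms(4)
    by (simp add: sum_distrib_right)
  also have "\<dots> = rep_action S r g (rep_action S r h f) a"
    unfolding rep_action_def sum_distrib_left by (subst sum.swap) (simp add: mult.assoc)
  finally show ?thesis .
qed

lemma rep_action_one:
  assumes "unitary_rep G S r" "a \<in> S"
  shows "rep_action S r \<one>\<^bsub>G\<^esub> f a = f a"
  using unitary_repD(1,3)[OF assms(1)] assms(2)
  by (simp add: rep_action_def if_distrib[of "\<lambda>z. z * _"] cong: if_cong)

lemma rep_action_adjoint:
  assumes "unitary_rep G S r" "g \<in> carrier G"
  shows "inner_on S (rep_action S r (inv\<^bsub>G\<^esub> g) f) h = inner_on S f (rep_action S r g h)"
proof -
  have "inner_on S (rep_action S r (inv\<^bsub>G\<^esub> g) f) h = (\<Sum>a\<in>S. \<Sum>b\<in>S. cnj (r g b a) * f b * cnj (h a))"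
    unfolding inner_on_def rep_action_def using unitary_repD(4)[OF assms]
    by (simp add: sum_distrib_right)
  also have "\<dots> = inner_on S f (rep_action S r g h)"
    unfolding inner_on_def rep_action_def cnj_sum sum_distrib_left
    by (subst sum.swap) (simp add: mult_ac)
  finally show ?thesis .
qed

text \<open>Restriction to an invariant subspace, written in an orthonormal basis. Orthonormality of
  the basis keeps the matrices unitary.\<close>

lemma unitary_rep_subrep:
  fixes m :: nat
  assumes grp: "group G" and r: "unitary_rep G S r"
    and inv: "\<And>g f. g \<in> carrier G \<Longrightarrow> f \<in> V \<Longrightarrow> rep_action S r g f \<in> V"
    and u: "orthonormal_on S {..<m} u" "\<And>k. k < m \<Longrightarrow> u k \<in> V"
      "\<And>f x. f \<in> V \<Longrightarrow> x \<in> S \<Longrightarrow> f x = (\<Sum>k<m. inner_on S f (u k) * u k x)"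
  defines "r' \<equiv> \<lambda>g k l. inner_on S (rep_action S r g (u l)) (u k)"
  shows "unitary_rep G {..<m} r'"
    and "\<And>g l a. g \<in> carrier G \<Longrightarrow> l < m \<Longrightarrow> a \<in> S \<Longrightarrow>
      rep_action S r g (u l) a = (\<Sum>k<m. r' g k l * u k a)"
proof -
  interpret group G by fact
  show exp: "rep_action S r g (u l) a = (\<Sum>k<m. r' g k l * u k a)"
    if "g \<in> carrier G" "l < m" "a \<in> S" for g l a
    unfolding r'_def using that by (intro u(3) inv u(2))
  have "r' (g \<otimes>\<^bsub>G\<^esub> h) j l = (\<Sum>k<m. r' g j k * r' h k l)"
    if g: "g \<in> carrier G" and h: "h \<in> carrier G" and "j < m" "l < m" for g h j l
  proof -
    have "r' (g \<otimes>\<^bsub>G\<^esub> h) j l = inner_on S (rep_action S r g (rep_action S r h (u l))) (u j)"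
      unfolding r'_def by (intro inner_on_cong rep_action_mult[OF r g h]) auto
    also have "rep_action S r g (rep_action S r h (u l)) = rep_action S r g (\<lambda>a. \<Sum>k<m. r' h k l * u k a)"
      by (intro rep_action_cong exp that)
    also have "inner_on S \<dots> (u j) = inner_on S (\<lambda>a. \<Sum>k<m. r' h k l * rep_action S r g (u k) a) (u j)"
      by (intro inner_on_cong rep_action_sum refl)
    also have "\<dots> = (\<Sum>k<m. r' g j k * r' h k l)"
      unfolding inner_on_sum_left by (simp add: r'_def mult.commute)
    finally show ?thesis .
  qed
  moreover have "r' \<one>\<^bsub>G\<^esub> k l = (if k = l then 1 else 0)" if "k < m" "l < m" for k l
  proof -
    have "r' \<one>\<^bsub>G\<^esub> k l = inner_on S (u l) (u k)"
      unfolding r'_def by (intro inner_on_cong rep_action_one[OF r]) auto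
    then show ?thesis using u(1) that by (auto simp: orthonormal_on_def)
  qed
  moreover have "r' (inv\<^bsub>G\<^esub> g) k l = cnj (r' g l k)" if "g \<in> carrier G" for g k l
    unfolding r'_def rep_action_adjoint[OF r that] by (rule inner_on_commute)
  ultimately show "unitary_rep G {..<m} r'"
    by (auto simp: unitary_rep_def)
qed

lemma group_sum_translate:
  fixes G (structure)
  assumes "group G" "h \<in> carrier G"
  shows "(\<Sum>g\<in>carrier G. f (h \<otimes>\<^bsub>G\<^esub> g)) = (\<Sum>g\<in>carrier G. f g)"
proof -
  interpret group G by fact
  have "bij_betw (\<lambda>g. h \<otimes>\<^bsub>G\<^esub> g) (carrier G) (carrier G)"
    by (rule bij_betw_byWitness[where f' = "\<lambda>g. inv\<^bsub>G\<^esub> h \<otimes>\<^bsub>G\<^esub> g"])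
      (use assms(2) in \<open>auto simp flip: m_assoc\<close>)
  then show ?thesis by (rule sum.reindex_bij_betw)
qed

text \<open>An eigenspace of the commuting matrix \<open>A\<close> is invariant, and by unitarity so
  is its orthogonal complement. As \<open>A\<close> is not scalar, both have dimension less than
  \<open>n\<close>, so their matrix coefficients lie in \<open>W\<close> by \<open>small\<close>;
  the coefficients of \<open>r\<close> are linear combinations of these.\<close>

lemma unitary_rep_split:
  fixes n :: nat
  assumes grp: "group G" and r: "unitary_rep G {..<n} r"
    and comm: "\<And>g a b. g \<in> carrier G \<Longrightarrow> a < n \<Longrightarrow> b < n \<Longrightarrow>
      (\<Sum>c<n. r g a c * A c b) = (\<Sum>c<n. A a c * r g c b)"
    and nonscalar: "\<And>ev. \<exists>a<n. \<exists>b<n. A a b \<noteq> (if a = b then ev else 0)"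
    and W: "linear_subspace W" "\<And>f f'. f \<in> W \<Longrightarrow> (\<And>g. g \<in> carrier G \<Longrightarrow> f g = f' g) \<Longrightarrow> f' \<in> W"
    and small: "\<And>m r' k l. m < n \<Longrightarrow> unitary_rep G {..<m} r' \<Longrightarrow> k < m \<Longrightarrow> l < m \<Longrightarrow>
      (\<lambda>g. r' g k l) \<in> W"
    and ab: "a < n" "b < n"
  shows "(\<lambda>g. r g a b) \<in> W"
proof -
  interpret group G by fact
  let ?S = "{..<n}"
  have "n > 0" using ab by simp
  then obtain v ev where v0: "\<exists>a<n. v a \<noteq> 0"
    and v: "\<And>a. a < n \<Longrightarrow> (\<Sum>b<n. A a b * v b) = ev * v a"
    by (rule ex_eigenvector[where A = A]) (rule that)
  define V where "V = {f. \<forall>a<n. (\<Sum>b<n. A a b * f b) = ev * f a}"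
  have V: "linear_subspace V"
    by (auto simp: linear_subspace_def V_def algebra_simps sum.distrib simp flip: sum_distrib_left)
  have vV: "v \<in> V" using v by (simp add: V_def)
  have invV: "rep_action ?S r g f \<in> V" if g: "g \<in> carrier G" and f: "f \<in> V" for g f
  proof -
    have "(\<Sum>b<n. A a b * rep_action ?S r g f b) = ev * rep_action ?S r g f a" if "a < n" for a
    proof -
      have "(\<Sum>b<n. A a b * rep_action ?S r g f b) = (\<Sum>c<n. (\<Sum>b<n. A a b * r g b c) * f c)"
        unfolding rep_action_def sum_distrib_left sum_distrib_right
        by (subst sum.swap) (simp add: mult_ac)
      also have "\<dots> = (\<Sum>c<n. (\<Sum>b<n. r g a b * A b c) * f c)"
        using comm[OF g that] by simp
      also have "\<dots> = (\<Sum>b<n. r g a b * (\<Sum>c<n. A b c * f c))"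
        unfolding sum_distrib_left sum_distrib_right by (subst sum.swap) (simp add: mult_ac)
      also have "\<dots> = (\<Sum>b<n. r g a b * (ev * f b))"
        using f by (simp add: V_def)
      also have "\<dots> = ev * rep_action ?S r g f a"
        by (simp add: rep_action_def sum_distrib_left mult_ac)
      finally show ?thesis .
    qed
    then show ?thesis by (simp add: V_def)
  qed
  define V' where "V' = orthogonal_complement ?S V"
  have V': "linear_subspace V'"
    unfolding V'_def by (rule linear_subspace_orthogonal_complement)
  have invV': "rep_action ?S r g f \<in> V'" if g: "g \<in> carrier G" and f: "f \<in> V'" for g f
  proof -
    have "inner_on ?S (rep_action ?S r g f) w = 0" if "w \<in> V" for w
      using rep_action_adjoint[OF r inv_closed[OF g], of f w] invV[OF inv_closed[OF g] that] g f
      by (simp add: V'_def orthogonal_complement_def)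
    then show ?thesis by (simp add: V'_def orthogonal_complement_def)
  qed
  obtain u and m :: nat where u: "orthonormal_on ?S {..<m} u" "\<And>k. k < m \<Longrightarrow> u k \<in> V"
    "\<And>f x. f \<in> V \<Longrightarrow> x \<in> ?S \<Longrightarrow> f x = (\<Sum>k<m. inner_on ?S f (u k) * u k x)"
    by (rule ex_orthonormal_basis[OF finite_lessThan[of n] V]) blast
  obtain w and m' :: nat where w: "orthonormal_on ?S {..<m'} w" "\<And>k. k < m' \<Longrightarrow> w k \<in> V'"
    "\<And>f x. f \<in> V' \<Longrightarrow> x \<in> ?S \<Longrightarrow> f x = (\<Sum>k<m'. inner_on ?S f (w k) * w k x)"
    by (rule ex_orthonormal_basis[OF finite_lessThan[of n] V']) blast
  \<comment> \<open>A full eigenspace would contain every standard basis vector, which makes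
    \<open>A\<close> scalar.\<close>
  have "m \<noteq> n"
  proof
    assume "m = n"
    have all: "f \<in> V" for f
    proof -
      have f: "f x = (\<Sum>k<m. inner_on ?S f (u k) * u k x)" if "x < n" for x
        by (rule orthonormal_on_expansion[OF _ _ u(1)]) (use that \<open>m = n\<close> in auto)
      have "(\<lambda>x. \<Sum>k<m. inner_on ?S f (u k) * u k x) \<in> V"
        by (rule linear_subspace_sum[OF V]) (use u(2) in auto)
      then show ?thesis by (simp add: V_def flip: f)
    qed
    obtain a b where *: "a < n" "b < n" "A a b \<noteq> (if a = b then ev else 0)"
      using nonscalar by blast
    have "(\<Sum>c<n. A a c * (if c = b then 1 else 0)) = ev * (if a = b then 1 else 0)"
      using all[of "\<lambda>c. if c = b then 1 else 0"] *(1) by (simp add: V_def)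
    then show False using * by (simp add: if_distrib[of "\<lambda>z. _ * z"] cong: if_cong)
  qed
  moreover have "m \<le> n" using orthonormal_on_card_le[OF _ _ u(1)] by simp
  ultimately have mn: "m < n" by simp
  \<comment> \<open>A full complement would make the eigenvector \<open>v\<close> orthogonal to
    everything, hence zero.\<close>
  have "m' \<noteq> n"
  proof
    assume "m' = n"
    have "v x = (\<Sum>k<m'. inner_on ?S v (w k) * w k x)" if "x < n" for x
      by (rule orthonormal_on_expansion[OF _ _ w(1)]) (use that \<open>m' = n\<close> in auto)
    moreover have "inner_on ?S v (w k) = 0" if "k < m'" for k
    proof -
      have "inner_on ?S (w k) v = 0"
        using w(2)[OF that] vV by (simp add: V'_def orthogonal_complement_def)
      then show ?thesis by (subst inner_on_commute) simp
    qed
    ultimately show False using v0 by auto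
  qed
  moreover have "m' \<le> n" using orthonormal_on_card_le[OF _ _ w(1)] by simp
  ultimately have mn': "m' < n" by simp
  define r1 where "r1 = (\<lambda>g k l. inner_on ?S (rep_action ?S r g (u l)) (u k))"
  define r2 where "r2 = (\<lambda>g k l. inner_on ?S (rep_action ?S r g (w l)) (w k))"
  have rep1: "unitary_rep G {..<m} r1"
    unfolding r1_def by (rule unitary_rep_subrep(1)[where V = V]) (fact grp r invV u)+
  have act1: "rep_action ?S r g (u l) a = (\<Sum>k<m. r1 g k l * u k a)"
    if "g \<in> carrier G" "l < m" "a \<in> ?S" for g l a
    unfolding r1_def
    by (rule unitary_rep_subrep(2)[where V = V]) (fact grp r invV u that)+
  have rep2: "unitary_rep G {..<m'} r2"
    unfolding r2_def by (rule unitary_rep_subrep(1)[where V = V']) (fact grp r invV' w)+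
  have act2: "rep_action ?S r g (w l) a = (\<Sum>k<m'. r2 g k l * w k a)"
    if "g \<in> carrier G" "l < m'" "a \<in> ?S" for g l a
    unfolding r2_def
    by (rule unitary_rep_subrep(2)[where V = V']) (fact grp r invV' w that)+
  \<comment> \<open>The standard basis vector at \<open>b\<close>: entry \<open>a\<close> of its
    image under \<open>r g\<close> is \<open>r g a b\<close>, so decomposing \<open>e\<close> along
    the two subspaces decomposes this coefficient.\<close>
  define e where "e = (\<lambda>c. if b = c then 1 else 0 :: complex)"
  have eu: "inner_on ?S e f = cnj (f b)" for f
    unfolding e_def using ab by (intro inner_on_kronecker) auto
  have dec: "e x = (\<Sum>k<m. cnj (u k b) * u k x) + (\<Sum>k<m'. cnj (w k b) * w k x)" if "x < n" for x
    using orthogonal_decomposition[OF _ V u w(2)[unfolded V'_def] w(3)[unfolded V'_def], of x e] that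
    by (simp add: eu)
  have rab: "r g a b = (\<Sum>l<m. \<Sum>k<m. (cnj (u l b) * u k a) * r1 g k l)
      + (\<Sum>l<m'. \<Sum>k<m'. (cnj (w l b) * w k a) * r2 g k l)" if g: "g \<in> carrier G" for g
  proof -
    have "r g a b = rep_action ?S r g e a"
      using ab by (simp add: rep_action_def e_def if_distrib[of "\<lambda>z. _ * z"] cong: if_cong)
    also have "\<dots> = rep_action ?S r g (\<lambda>x. (\<Sum>k<m. cnj (u k b) * u k x) + (\<Sum>k<m'. cnj (w k b) * w k x)) a"
      by (rule fun_cong[OF rep_action_cong]) (simp add: dec)
    also have "\<dots> = rep_action ?S r g (\<lambda>x. \<Sum>k<m. cnj (u k b) * u k x) a
        + rep_action ?S r g (\<lambda>x. \<Sum>k<m'. cnj (w k b) * w k x) a"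
      by (simp add: rep_action_def algebra_simps sum.distrib)
    also have "\<dots> = (\<Sum>l<m. cnj (u l b) * (\<Sum>k<m. r1 g k l * u k a))
        + (\<Sum>l<m'. cnj (w l b) * (\<Sum>k<m'. r2 g k l * w k a))"
      using act1[OF g] act2[OF g] ab by (simp add: rep_action_sum)
    finally show ?thesis by (simp add: sum_distrib_left mult_ac)
  qed
  \<comment> \<open>The factor 1 gives the outer sum the shape of
    \<open>linear_subspace_sum\<close>, which then applies to both sums.\<close>
  have 1: "(\<lambda>g. \<Sum>l<m. 1 * (\<Sum>k<m. (cnj (u l b) * u k a) * r1 g k l)) \<in> W"
    by (intro linear_subspace_sum W(1) small[OF mn rep1]) auto
  have 2: "(\<lambda>g. \<Sum>l<m'. 1 * (\<Sum>k<m'. (cnj (w l b) * w k a) * r2 g k l)) \<in> W"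
    by (intro linear_subspace_sum W(1) small[OF mn' rep2]) auto
  show ?thesis
    by (rule W(2)[OF linear_subspace_add_scale[OF W(1) 1 2, of 1]]) (simp add: rab)
qed

text \<open>The sums over the group are the entries of the average of r(g) E s(g)^-1, where E is the
  matrix unit at \<open>(b, d)\<close>. Translating the summation variable by \<open>h\<close> shows
  that the average intertwines \<open>r\<close> and \<open>s\<close>. Only multiplicativity is asked
  of \<open>r\<close>, since it will also be an irreducible representation that is not assumed
  unitary.\<close>

lemma averaged_intertwiner:
  fixes G (structure)
  assumes grp: "group G" and s: "unitary_rep G T s"
    and r: "\<And>g h a c. g \<in> carrier G \<Longrightarrow> h \<in> carrier G \<Longrightarrow> a \<in> S \<Longrightarrow> c \<in> S \<Longrightarrow>
      r (g \<otimes>\<^bsub>G\<^esub> h) a c = (\<Sum>e\<in>S. r g a e * r h e c)"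
    and mem: "b \<in> S" "d \<in> T" "h \<in> carrier G" "a \<in> S" "c \<in> T"
  shows "(\<Sum>e\<in>S. r h a e * (\<Sum>g\<in>carrier G. r g e b * cnj (s g c d)))
    = (\<Sum>e\<in>T. (\<Sum>g\<in>carrier G. r g a b * cnj (s g e d)) * s h e c)"
proof -
  interpret group G by fact
  have "(\<Sum>e\<in>T. (\<Sum>g\<in>carrier G. r g a b * cnj (s g e d)) * s h e c)
    = (\<Sum>g\<in>carrier G. r g a b * cnj (\<Sum>e\<in>T. cnj (s h e c) * s g e d))"
    unfolding cnj_sum sum_distrib_left sum_distrib_right by (subst sum.swap) (simp add: mult_ac)
  also have "\<dots> = (\<Sum>g\<in>carrier G. r g a b * cnj (s (inv h \<otimes> g) c d))"
    using unitary_repD(2,4)[OF s] mem by simp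
  also have "\<dots> = (\<Sum>g\<in>carrier G. r (h \<otimes> g) a b * cnj (s (inv h \<otimes> (h \<otimes> g)) c d))"
    by (rule group_sum_translate[OF grp mem(3), symmetric])
  also have "\<dots> = (\<Sum>g\<in>carrier G. (\<Sum>e\<in>S. r h a e * r g e b) * cnj (s g c d))"
    using mem by (intro sum.cong refl) (simp add: r m_assoc[symmetric])
  also have "\<dots> = (\<Sum>e\<in>S. r h a e * (\<Sum>g\<in>carrier G. r g e b * cnj (s g c d)))"
    unfolding sum_distrib_left sum_distrib_right by (subst sum.swap) (simp add: mult_ac)
  finally show ?thesis ..
qed

lemma unitary_rep_columns:
  assumes grp: "group G" and r: "unitary_rep G S r" and mem: "g \<in> carrier G" "b \<in> S" "d \<in> S"
  shows "(\<Sum>a\<in>S. r g a b * cnj (r g a d)) = (if b = d then 1 else 0)"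
proof -
  interpret group G by fact
  have "(\<Sum>a\<in>S. r g a b * cnj (r g a d)) = (\<Sum>a\<in>S. r (inv\<^bsub>G\<^esub> g) d a * r g a b)"
    using unitary_repD(4)[OF r] mem by (simp add: mult.commute)
  also have "\<dots> = r \<one>\<^bsub>G\<^esub> d b"
    using unitary_repD(2)[OF r, of "inv\<^bsub>G\<^esub> g" g d b] mem by simp
  finally show ?thesis using unitary_repD(3)[OF r] mem by auto
qed

section \<open>Schur orthogonality for representations with scalar commutant\<close>

definition scalar_commutant :: "('a, 'c) monoid_scheme \<Rightarrow> 'k set \<Rightarrow> ('a \<Rightarrow> 'k \<Rightarrow> 'k \<Rightarrow> complex) \<Rightarrow> bool" where
  "scalar_commutant G S r \<longleftrightarrow> (\<forall>A.
     (\<forall>g\<in>carrier G. \<forall>a\<in>S. \<forall>b\<in>S. (\<Sum>c\<in>S. r g a c * A c b) = (\<Sum>c\<in>S. A a c * r g c b)) \<longrightarrow>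
     (\<exists>ev. \<forall>a\<in>S. \<forall>b\<in>S. A a b = (if a = b then ev else 0)))"

lemma scalar_commutantD:
  assumes "scalar_commutant G S r"
    and "\<And>g a b. g \<in> carrier G \<Longrightarrow> a \<in> S \<Longrightarrow> b \<in> S \<Longrightarrow> (\<Sum>c\<in>S. r g a c * A c b) = (\<Sum>c\<in>S. A a c * r g c b)"
  obtains ev where "\<And>a b. a \<in> S \<Longrightarrow> b \<in> S \<Longrightarrow> A a b = (if a = b then ev else 0)"
  using assms unfolding scalar_commutant_def by blast

text \<open>The averaged matrix unit commutes with \<open>r\<close> and is therefore a scalar
  \<open>ev\<close>. Its trace, computed in two ways, fixes \<open>ev\<close>: each group element
  contributes the inner product of columns \<open>b\<close> and \<open>d\<close> of a unitary
  matrix.\<close>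

lemma schur_orthogonality:
  assumes grp: "group G" and r: "unitary_rep G S r" and sc: "scalar_commutant G S r"
    and mem: "a \<in> S" "b \<in> S" "c \<in> S" "d \<in> S"
  shows "inner_on (carrier G) (\<lambda>g. r g a b) (\<lambda>g. r g c d)
    = (if a = c \<and> b = d then of_nat (card (carrier G)) / of_nat (card S) else 0)"
proof -
  define A where "A = (\<lambda>a c. \<Sum>g\<in>carrier G. r g a b * cnj (r g c d))"
  have "(\<Sum>e\<in>S. r h a e * A e c) = (\<Sum>e\<in>S. A a e * r h e c)"
    if "h \<in> carrier G" "a \<in> S" "c \<in> S" for h a c
    unfolding A_def using averaged_intertwiner[OF grp r unitary_repD(2)[OF r] mem(2,4) that] by simp
  from scalar_commutantD[where A = A, OF sc this] obtain ev
    where ev: "\<And>a c. a \<in> S \<Longrightarrow> c \<in> S \<Longrightarrow> A a c = (if a = c then ev else 0)" by blast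
  have "of_nat (card S) * ev = (\<Sum>a\<in>S. A a a)" using ev by simp
  also have "\<dots> = (\<Sum>g\<in>carrier G. \<Sum>a\<in>S. r g a b * cnj (r g a d))"
    unfolding A_def by (rule sum.swap)
  also have "\<dots> = (if b = d then of_nat (card (carrier G)) else 0)"
    using unitary_rep_columns[OF grp r _ mem(2,4)] by simp
  finally have "ev = (if b = d then of_nat (card (carrier G)) / of_nat (card S) else 0)"
    using mem(1) unitary_repD(1)[OF r] by (auto simp: eq_divide_eq mult.commute card_eq_0_iff)
  then show ?thesis
    using ev[OF mem(1,3)] by (simp add: A_def inner_on_def)
qed

text \<open>The averaged matrix \<open>A\<close> intertwines \<open>r\<close> and \<open>s\<close>,
  so A times its adjoint commutes with \<open>r\<close> and is a scalar \<open>ev\<close>. A nonzero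
  \<open>ev\<close> would express every coefficient of \<open>r\<close> through coefficients of
  \<open>s\<close> and put it into \<open>W\<close>, against \<open>rW\<close>. With
  \<open>ev\<close> zero, each row of \<open>A\<close> has norm zero.\<close>

lemma schur_orthogonality_distinct:
  assumes grp: "group G" and r: "unitary_rep G S r" and s: "unitary_rep G T s" and sc: "scalar_commutant G S r"
    and W: "linear_subspace W" "\<And>f f'. f \<in> W \<Longrightarrow> (\<And>g. g \<in> carrier G \<Longrightarrow> f g = f' g) \<Longrightarrow> f' \<in> W"
    and sW: "\<And>c d. c \<in> T \<Longrightarrow> d \<in> T \<Longrightarrow> (\<lambda>g. s g c d) \<in> W"
    and rW: "\<exists>a\<in>S. \<exists>b\<in>S. (\<lambda>g. r g a b) \<notin> W"
    and mem: "a \<in> S" "b \<in> S" "c \<in> T" "d \<in> T"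
  shows "inner_on (carrier G) (\<lambda>g. r g a b) (\<lambda>g. s g c d) = 0"
proof -
  interpret group G by fact
  have fin: "finite S" "finite T" using r s by (auto dest: unitary_repD(1))
  define A where "A = (\<lambda>a c. \<Sum>g\<in>carrier G. r g a b * cnj (s g c d))"
  have A: "(\<Sum>e\<in>S. r h a e * A e c) = (\<Sum>e\<in>T. A a e * s h e c)"
    if "h \<in> carrier G" "a \<in> S" "c \<in> T" for h a c
    unfolding A_def using averaged_intertwiner[OF grp s unitary_repD(2)[OF r] mem(2,4) that] by simp
  \<comment> \<open>\<open>M\<close> is A times its adjoint. It commutes with \<open>r\<close>
    because \<open>A\<close> intertwines one way and, by unitarity, its adjoint the other
    way.\<close>
  define M where "M = (\<lambda>a b. \<Sum>c\<in>T. A a c * cnj (A b c))"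
  have rM: "(\<Sum>e\<in>S. r h a e * M e b) = (\<Sum>c\<in>T. \<Sum>e\<in>T. (A a e * cnj (A b c)) * s h e c)"
    if "h \<in> carrier G" "a \<in> S" for h a b
  proof -
    have "(\<Sum>e\<in>S. r h a e * M e b) = (\<Sum>c\<in>T. (\<Sum>e\<in>S. r h a e * A e c) * cnj (A b c))"
      unfolding M_def sum_distrib_left sum_distrib_right by (subst sum.swap) (simp add: mult_ac)
    also have "\<dots> = (\<Sum>c\<in>T. (\<Sum>e\<in>T. A a e * s h e c) * cnj (A b c))"
      using A[OF that] by simp
    finally show ?thesis by (simp add: sum_distrib_left sum_distrib_right mult_ac)
  qed
  have "(\<Sum>e\<in>S. r h a e * M e b) = (\<Sum>e\<in>S. M a e * r h e b)"
    if h: "h \<in> carrier G" and ab: "a \<in> S" "b \<in> S" for h a b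
  proof -
    have "(\<Sum>e\<in>S. M a e * r h e b) = (\<Sum>c\<in>T. A a c * cnj (\<Sum>e\<in>S. r (inv\<^bsub>G\<^esub> h) b e * A e c))"
      unfolding M_def cnj_sum sum_distrib_left sum_distrib_right
      by (subst sum.swap) (simp add: mult_ac unitary_repD(4)[OF r h ab(2)])
    also have "\<dots> = (\<Sum>c\<in>T. A a c * cnj (\<Sum>e\<in>T. A b e * s (inv\<^bsub>G\<^esub> h) e c))"
      using A[OF inv_closed[OF h] ab(2)] by simp
    also have "\<dots> = (\<Sum>c\<in>T. \<Sum>e\<in>T. (A a c * cnj (A b e)) * s h c e)"
      unfolding cnj_sum sum_distrib_left
      by (intro sum.cong refl) (simp add: unitary_repD(4)[OF s h] mult_ac)
    also have "\<dots> = (\<Sum>e\<in>T. \<Sum>c\<in>T. (A a c * cnj (A b e)) * s h c e)"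
      by (rule sum.swap)
    finally show ?thesis using rM[OF h ab(1)] by simp
  qed
  from scalar_commutantD[where A = M, OF sc this] obtain ev
    where ev: "\<And>a b. a \<in> S \<Longrightarrow> b \<in> S \<Longrightarrow> M a b = (if a = b then ev else 0)" by blast
  have "ev = 0"
  proof (rule ccontr)
    assume "ev \<noteq> 0"
    obtain a b where ab: "a \<in> S" "b \<in> S" and notW: "(\<lambda>g. r g a b) \<notin> W" using rW by blast
    \<comment> \<open>This is entry \<open>(a, b)\<close> of A s(g) times the adjoint of A, divided
      by \<open>ev\<close>; by \<open>rM\<close> it equals \<open>r g a b\<close>.\<close>
    have "(\<lambda>g. \<Sum>c\<in>T. inverse ev * (\<Sum>e\<in>T. (A a e * cnj (A b c)) * s g e c)) \<in> W"
      by (intro linear_subspace_sum W(1) fin sW)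
    moreover have "(\<Sum>c\<in>T. inverse ev * (\<Sum>e\<in>T. (A a e * cnj (A b c)) * s g e c)) = r g a b"
      if g: "g \<in> carrier G" for g
    proof -
      have "(\<Sum>e\<in>S. r g a e * M e b) = (\<Sum>e\<in>S. if e = b then r g a e * ev else 0)"
        using ev ab by (intro sum.cong) auto
      also have "\<dots> = r g a b * ev" using ab fin by simp
      finally show ?thesis
        using rM[OF g ab(1), of b] \<open>ev \<noteq> 0\<close> by (simp flip: sum_distrib_left)
    qed
    ultimately have "(\<lambda>g. r g a b) \<in> W" by (rule W(2))
    with notW show False ..
  qed
  then have "inner_on T (A a) (A a) = 0"
    using ev[OF mem(1) mem(1)] by (simp add: M_def inner_on_def)
  then have "A a c = 0" using inner_on_self_eq_0[OF fin(2)] mem(3) by blast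
  then show ?thesis by (simp add: A_def inner_on_def)
qed

section \<open>Complete systems of irreducible representations\<close>

definition orthogonal_system ::
    "('a, 'c) monoid_scheme \<Rightarrow> 'i set \<Rightarrow> ('i \<Rightarrow> 'k set) \<Rightarrow> ('i \<Rightarrow> 'a \<Rightarrow> 'k \<Rightarrow> 'k \<Rightarrow> complex) \<Rightarrow> bool" where
  "orthogonal_system G I S r \<longleftrightarrow> finite I \<and> (\<forall>i\<in>I. S i \<noteq> {} \<and> unitary_rep G (S i) (r i)) \<and>
     (\<forall>i\<in>I. \<forall>j\<in>I. \<forall>a\<in>S i. \<forall>b\<in>S i. \<forall>c\<in>S j. \<forall>d\<in>S j.
        inner_on (carrier G) (\<lambda>g. r i g a b) (\<lambda>g. r j g c d) =
        (if i = j \<and> a = c \<and> b = d then of_nat (card (carrier G)) / of_nat (card (S i)) else 0))"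

definition complete_system ::
    "('a, 'c) monoid_scheme \<Rightarrow> 'i set \<Rightarrow> ('i \<Rightarrow> 'k set) \<Rightarrow> ('i \<Rightarrow> 'a \<Rightarrow> 'k \<Rightarrow> 'k \<Rightarrow> complex) \<Rightarrow> bool" where
  "complete_system G I S r \<longleftrightarrow> orthogonal_system G I S r \<and> (\<Sum>i\<in>I. (card (S i))\<^sup>2) = card (carrier G)"

lemma orthogonal_systemD:
  assumes "orthogonal_system G I S r"
  shows "finite I" "\<And>i. i \<in> I \<Longrightarrow> S i \<noteq> {}" "\<And>i. i \<in> I \<Longrightarrow> unitary_rep G (S i) (r i)"
    and "\<And>i. i \<in> I \<Longrightarrow> finite (S i)" "\<And>i. i \<in> I \<Longrightarrow> card (S i) > 0"
    and "\<And>i j a b c d. i \<in> I \<Longrightarrow> j \<in> I \<Longrightarrow> a \<in> S i \<Longrightarrow> b \<in> S i \<Longrightarrow> c \<in> S j \<Longrightarrow> d \<in> S j \<Longrightarrow>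
      inner_on (carrier G) (\<lambda>g. r i g a b) (\<lambda>g. r j g c d) =
      (if i = j \<and> a = c \<and> b = d then of_nat (card (carrier G)) / of_nat (card (S i)) else 0)"
  using assms unfolding orthogonal_system_def
  by (blast, blast, blast, blast dest: unitary_repD(1), auto dest: unitary_repD(1) simp: card_gt_0_iff)

definition coefficient_index :: "'i set \<Rightarrow> ('i \<Rightarrow> 'k set) \<Rightarrow> ('i \<times> 'k \<times> 'k) set" where
  "coefficient_index I S = Sigma I (\<lambda>i. S i \<times> S i)"

text \<open>Schur orthogonality gives a coefficient of a representation of degree d the squared norm
  |G|/d; the square root normalises it to length one.\<close>

definition coefficient_family ::
    "('a, 'c) monoid_scheme \<Rightarrow> ('i \<Rightarrow> 'k set) \<Rightarrow> ('i \<Rightarrow> 'a \<Rightarrow> 'k \<Rightarrow> 'k \<Rightarrow> complex) \<Rightarrow>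
      'i \<times> 'k \<times> 'k \<Rightarrow> 'a \<Rightarrow> complex" where
  "coefficient_family G S r = (\<lambda>(i, a, b) g.
     complex_of_real (sqrt (real (card (S i)) / real (card (carrier G)))) * r i g a b)"

lemma finite_coefficient_index: "orthogonal_system G I S r \<Longrightarrow> finite (coefficient_index I S)"
  using orthogonal_systemD(1,4)[of G I S r] by (auto simp: coefficient_index_def)

lemma card_coefficient_index:
  "orthogonal_system G I S r \<Longrightarrow> card (coefficient_index I S) = (\<Sum>i\<in>I. (card (S i))\<^sup>2)"
  using orthogonal_systemD(1,4)[of G I S r]
  by (simp add: coefficient_index_def card_SigmaI card_cartesian_product power2_eq_square)

lemma orthonormal_coefficient_family:
  assumes grp: "group G" and fin: "finite (carrier G)" and sys: "orthogonal_system G I S r"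
  shows "orthonormal_on (carrier G) (coefficient_index I S) (coefficient_family G S r)"
  unfolding orthonormal_on_def
proof (intro ballI)
  fix x y assume xy: "x \<in> coefficient_index I S" "y \<in> coefficient_index I S"
  obtain i a b j c d where x: "x = (i, a, b)" and y: "y = (j, c, d)" by (metis prod.exhaust)
  have mem: "i \<in> I" "j \<in> I" "a \<in> S i" "b \<in> S i" "c \<in> S j" "d \<in> S j"
    using xy by (auto simp: x y coefficient_index_def)
  interpret group G by fact
  let ?N = "real (card (carrier G))"
  have N: "?N > 0" using fin one_closed by (auto simp: card_gt_0_iff)
  have d: "card (S i) > 0" using orthogonal_systemD(5)[OF sys mem(1)] .
  show "inner_on (carrier G) (coefficient_family G S r x) (coefficient_family G S r y) = (if x = y then 1 else 0)"
  proof (cases "x = y")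
    case True
    define z where "z = complex_of_real (sqrt (real (card (S i)) / ?N))"
    have zz: "z * z = of_nat (card (S i)) / of_nat (card (carrier G))"
      by (simp add: z_def flip: of_real_mult)
    have "inner_on (carrier G) (coefficient_family G S r x) (coefficient_family G S r y)
      = z * z * (of_nat (card (carrier G)) / of_nat (card (S i)))"
      using True orthogonal_systemD(6)[OF sys mem]
      by (simp add: coefficient_family_def x y inner_on_scale_left inner_on_scale_right z_def mult.assoc)
    also have "\<dots> = 1"
      using N d by (simp add: zz)
    finally show ?thesis using True by simp
  next
    case False
    then show ?thesis using orthogonal_systemD(6)[OF sys mem]
      by (auto simp: coefficient_family_def x y inner_on_scale_left inner_on_scale_right)
  qed
qed

section \<open>Existence of complete systems\<close>

lemma unitary_rep_reindex:
  assumes "unitary_rep G S r" "bij_betw f T S"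
  shows "unitary_rep G T (\<lambda>g a b. r g (f a) (f b))"
proof -
  have f: "f a \<in> S" if "a \<in> T" for a using assms(2) that by (auto dest: bij_betwE)
  have inj: "f a = f b \<longleftrightarrow> a = b" if "a \<in> T" "b \<in> T" for a b
    using assms(2) that by (auto simp: bij_betw_def dest: inj_onD)
  have sum: "(\<Sum>c\<in>T. r g (f a) (f c) * r h (f c) (f b)) = (\<Sum>c\<in>S. r g (f a) c * r h c (f b))" for g h a b
    by (rule sum.reindex_bij_betw[OF assms(2)])
  have "finite T" using bij_betw_finite[OF assms(2)] unitary_repD(1)[OF assms(1)] by simp
  then show ?thesis
    using unitary_repD[OF assms(1)] f inj by (auto simp: unitary_rep_def sum)
qed

text \<open>In the left regular representation, the column at the identity consists of the indicator
  functions of the group elements. Hence its coefficients span all functions on the group.\<close>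

lemma unitary_rep_regular:
  assumes grp: "group G" and fin: "finite (carrier G)"
  shows "unitary_rep G (carrier G) (\<lambda>g a b. if a = g \<otimes>\<^bsub>G\<^esub> b then 1 else 0)"
proof -
  interpret group G by fact
  have "(\<Sum>c\<in>carrier G. (if a = g \<otimes>\<^bsub>G\<^esub> c then 1 else 0) * (if c = h \<otimes>\<^bsub>G\<^esub> b then 1 else 0 :: complex))
    = (if a = g \<otimes>\<^bsub>G\<^esub> h \<otimes>\<^bsub>G\<^esub> b then 1 else 0)"
    if "g \<in> carrier G" "h \<in> carrier G" "b \<in> carrier G" for g h a b
    using that fin by (simp add: if_distrib[of "\<lambda>z. _ * z"] m_assoc cong: if_cong)
  moreover have "a = inv\<^bsub>G\<^esub> g \<otimes>\<^bsub>G\<^esub> b \<longleftrightarrow> b = g \<otimes>\<^bsub>G\<^esub> a"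
    if "g \<in> carrier G" "a \<in> carrier G" "b \<in> carrier G" for g a b
    using that inv_solve_left[of a g b] by auto
  ultimately show ?thesis using fin by (auto simp: unitary_rep_def)
qed

text \<open>\<open>W\<close> is the span of the coefficients already present, and \<open>P n\<close>
  says that degree \<open>n\<close> admits a unitary representation with a coefficient outside
  \<open>W\<close>. The least such \<open>n\<close> is the degree to be added: a nonscalar commuting
  matrix would split the representation into smaller ones, whose coefficients all lie in
  \<open>W\<close>.\<close>

lemma orthogonal_system_extend:
  fixes d :: "nat \<Rightarrow> nat"
  assumes grp: "group G" and fin: "finite (carrier G)"
    and sys: "orthogonal_system G {..<m} (\<lambda>i. {..<d i}) r"
    and incomplete: "(\<Sum>i<m. (d i)\<^sup>2) < card (carrier G)"
  obtains n s where "n > 0" "orthogonal_system G {..<Suc m} (\<lambda>i. {..<(d(m := n)) i}) (r(m := s))"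
proof -
  interpret group G by fact
  let ?X = "coefficient_index {..<m} (\<lambda>i. {..<d i})"
  let ?u = "coefficient_family G (\<lambda>i. {..<d i}) r"
  define W where "W = reproduced (carrier G) ?X ?u"
  have X: "finite ?X" and on: "orthonormal_on (carrier G) ?X ?u"
    by (rule finite_coefficient_index[OF sys], rule orthonormal_coefficient_family[OF grp fin sys])
  have W: "linear_subspace W" "\<And>f f'. f \<in> W \<Longrightarrow> (\<And>g. g \<in> carrier G \<Longrightarrow> f g = f' g) \<Longrightarrow> f' \<in> W"
    unfolding W_def by (rule linear_subspace_reproduced) (rule reproduced_cong)
  have N: "card (carrier G) > 0" using fin one_closed by (auto simp: card_gt_0_iff)
  have rW: "(\<lambda>g. r i g a b) \<in> W" if "i < m" "a < d i" "b < d i" for i a b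
  proof -
    have "?u (i, a, b) \<in> W"
      unfolding W_def using X on by (rule reproduced_member) (use that in \<open>simp add: coefficient_index_def\<close>)
    from linear_subspace_add_scale[OF W(1) linear_subspace_zero[OF W(1)] this,
        of "1 / complex_of_real (sqrt (real (d i) / real (card (carrier G))))"]
    show ?thesis using N that by (simp add: coefficient_family_def)
  qed
  define P where "P = (\<lambda>n :: nat. \<exists>s. unitary_rep G {..<n} s \<and> (\<exists>a<n. \<exists>b<n. (\<lambda>g. s g a b) \<notin> W))"
  \<comment> \<open>Otherwise the coefficients of the regular representation would lie in
    \<open>W\<close>, so \<open>W\<close> would contain all indicator functions and the system would
    already be complete.\<close>
  have "\<exists>n. P n"
  proof (rule ccontr)
    assume none: "\<not> (\<exists>n. P n)"
    \<comment> \<open>\<open>P\<close> speaks of index sets that are initial segments of the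
      naturals, so the regular representation has to be renumbered.\<close>
    obtain e where e: "bij_betw e {..<card (carrier G)} (carrier G)"
      using ex_bij_betw_nat_finite[OF fin] by (auto simp: atLeast0LessThan)
    have "(\<lambda>g. if g = y then 1 else 0) \<in> W" if y: "y \<in> carrier G" for y
    proof -
      have surj: "\<exists>a<card (carrier G). e a = z" if "z \<in> carrier G" for z
      proof -
        have "z \<in> e ` {..<card (carrier G)}" using that bij_betw_imp_surj_on[OF e] by simp
        then show ?thesis by auto
      qed
      obtain a b where ab: "a < card (carrier G)" "e a = y" "b < card (carrier G)" "e b = \<one>\<^bsub>G\<^esub>"
        using surj[OF y] surj[OF one_closed] by blast
      have "(\<lambda>g. if e a = g \<otimes>\<^bsub>G\<^esub> e b then 1 else 0) \<in> W"
        using none unitary_rep_reindex[OF unitary_rep_regular[OF grp fin] e] ab(1,3)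
        unfolding P_def by blast
      then show ?thesis
        by (rule W(2)) (use ab in auto)
    qed
    then have "card ?X = card (carrier G)"
      unfolding W_def by (rule reproduced_kronecker_card[OF fin X on])
    then show False using incomplete card_coefficient_index[OF sys] by simp
  qed
  then have "P (LEAST n. P n)" by (rule LeastI_ex)
  moreover define n where "n = (LEAST n. P n)"
  ultimately obtain s where s: "unitary_rep G {..<n} s" and sW: "\<exists>a\<in>{..<n}. \<exists>b\<in>{..<n}. (\<lambda>g. s g a b) \<notin> W"
    unfolding P_def by blast
  have small: "(\<lambda>g. s' g k l) \<in> W" if "n' < n" "unitary_rep G {..<n'} s'" "k < n'" "l < n'" for n' s' k l
    using not_less_Least[of n' P] that unfolding n_def P_def by blast
  have n: "n > 0" using sW by auto
  have sc: "scalar_commutant G {..<n} s"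
    unfolding scalar_commutant_def
  proof (intro allI impI, rule ccontr)
    fix A
    assume comm: "\<forall>g\<in>carrier G. \<forall>a\<in>{..<n}. \<forall>b\<in>{..<n}. (\<Sum>c<n. s g a c * A c b) = (\<Sum>c<n. A a c * s g c b)"
      and "\<nexists>ev. \<forall>a\<in>{..<n}. \<forall>b\<in>{..<n}. A a b = (if a = b then ev else 0)"
    then have ns: "\<exists>a<n. \<exists>b<n. A a b \<noteq> (if a = b then ev else 0)" for ev by blast
    have comm': "(\<Sum>c<n. s g a c * A c b) = (\<Sum>c<n. A a c * s g c b)"
      if "g \<in> carrier G" "a < n" "b < n" for g a b
      using comm that by simp
    have "(\<lambda>g. s g a b) \<in> W" if "a < n" "b < n" for a b
      by (rule unitary_rep_split[where A = A and W = W]) (fact grp s comm' ns W small that)+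
    then show False using sW by blast
  qed
  have self: "inner_on (carrier G) (\<lambda>g. s g a b) (\<lambda>g. s g c e)
      = (if a = c \<and> b = e then of_nat (card (carrier G)) / of_nat n else 0)"
    if "a < n" "b < n" "c < n" "e < n" for a b c e
    using schur_orthogonality[OF grp s sc, of a b c e] that by simp
  have cross: "inner_on (carrier G) (\<lambda>g. s g a b) (\<lambda>g. r i g c e) = 0"
    if "i < m" "a < n" "b < n" "c < d i" "e < d i" for i a b c e
  proof (rule schur_orthogonality_distinct[where S = "{..<n}" and W = W])
    show "unitary_rep G {..<d i} (r i)" using orthogonal_systemD(3)[OF sys, of i] that by simp
    show "(\<lambda>g. r i g c e) \<in> W" if "c \<in> {..<d i}" "e \<in> {..<d i}" for c e
      using rW \<open>i < m\<close> that by simp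
  qed (fact grp s sc W sW | use that in simp)+
  have cross': "inner_on (carrier G) (\<lambda>g. r i g c e) (\<lambda>g. s g a b) = 0"
    if "i < m" "a < n" "b < n" "c < d i" "e < d i" for i a b c e
    using cross[OF that] by (subst inner_on_commute) simp
  have "orthogonal_system G {..<Suc m} (\<lambda>i. {..<(d(m := n)) i}) (r(m := s))"
    unfolding orthogonal_system_def
  proof (intro conjI ballI)
    show "finite {..<Suc m}" by simp
  next
    fix i assume "i \<in> {..<Suc m}"
    then consider "i < m" | "i = m" by fastforce
    then show "{..<(d(m := n)) i} \<noteq> {}"
      by cases (use orthogonal_systemD(2)[OF sys, of i] n in \<open>simp_all add: lessThan_empty_iff\<close>)
    from \<open>i \<in> {..<Suc m}\<close> consider "i < m" | "i = m" by fastforce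
    then show "unitary_rep G {..<(d(m := n)) i} ((r(m := s)) i)"
      by cases (use orthogonal_systemD(3)[OF sys, of i] s in simp_all)
  next
    fix i j a b c e
    assume ij: "i \<in> {..<Suc m}" "j \<in> {..<Suc m}"
      and mem: "a \<in> {..<(d(m := n)) i}" "b \<in> {..<(d(m := n)) i}" "c \<in> {..<(d(m := n)) j}" "e \<in> {..<(d(m := n)) j}"
    from ij consider "i < m" "j < m" | "i < m" "j = m" | "i = m" "j < m" | "i = m" "j = m" by fastforce
    then show "inner_on (carrier G) (\<lambda>g. (r(m := s)) i g a b) (\<lambda>g. (r(m := s)) j g c e)
      = (if i = j \<and> a = c \<and> b = e then of_nat (card (carrier G)) / of_nat (card {..<(d(m := n)) i}) else 0)"
    proof cases
      case 1
      then show ?thesis using mem orthogonal_systemD(6)[OF sys, of i j a b c e] by simp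
    next
      case 2
      then show ?thesis using mem cross'[of i c e a b] by simp
    next
      case 3
      then show ?thesis using mem cross[of j a b c e] by simp
    next
      case 4
      then show ?thesis using mem self[of a b c e] by simp
    qed
  qed
  with n show ?thesis by (rule that)
qed

text \<open>Among all orthogonal systems, take one with the greatest sum of squared degrees. The sum
  counts an orthonormal family of functions on the group and so is at most the group order; if it
  were smaller, an extension would raise it by a positive square.\<close>

lemma ex_complete_system:
  assumes grp: "group G" and fin: "finite (carrier G)"
  obtains m :: nat and d :: "nat \<Rightarrow> nat" and r where "complete_system G {..<m} (\<lambda>i. {..<d i}) r"
proof -
  let ?Q = "\<lambda>k. \<exists>m (d :: nat \<Rightarrow> nat) r. orthogonal_system G {..<m :: nat} (\<lambda>i. {..<d i}) r \<and> (\<Sum>i<m. (d i)\<^sup>2) = k"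
  have "?Q 0"
    by (intro exI[of _ 0] exI[of _ "\<lambda>i. 0"] exI[of _ "\<lambda>i g a b. 0"]) (simp add: orthogonal_system_def)
  moreover have "\<forall>k. ?Q k \<longrightarrow> k < Suc (card (carrier G))"
  proof (intro allI impI, elim exE conjE)
    fix k m and d :: "nat \<Rightarrow> nat" and r
    assume sys: "orthogonal_system G {..<m :: nat} (\<lambda>i. {..<d i}) r" and k: "(\<Sum>i<m. (d i)\<^sup>2) = k"
    show "k < Suc (card (carrier G))"
      using orthonormal_on_card_le[OF fin finite_coefficient_index[OF sys]
          orthonormal_coefficient_family[OF grp fin sys]] card_coefficient_index[OF sys] k by simp
  qed
  ultimately have "\<exists>k. ?Q k \<and> (\<forall>k'. ?Q k' \<longrightarrow> k' \<le> k)"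
    by (rule ex_has_greatest_nat)
  then obtain k where "?Q k" and max: "\<And>k'. ?Q k' \<Longrightarrow> k' \<le> k" by blast
  then obtain m :: nat and d :: "nat \<Rightarrow> nat" and r where
    sys: "orthogonal_system G {..<m} (\<lambda>i. {..<d i}) r" and k: "(\<Sum>i<m. (d i)\<^sup>2) = k" by blast
  have "\<not> (\<Sum>i<m. (d i)\<^sup>2) < card (carrier G)"
  proof
    assume "(\<Sum>i<m. (d i)\<^sup>2) < card (carrier G)"
    then obtain n s where n: "n > 0" and
      ext: "orthogonal_system G {..<Suc m} (\<lambda>i. {..<(d(m := n)) i}) (r(m := s))"
      by (rule orthogonal_system_extend[OF grp fin sys])
    have "(\<Sum>i<Suc m. ((d(m := n)) i)\<^sup>2) = k + n\<^sup>2" using k by simp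
    with ext have "?Q (k + n\<^sup>2)"
      by (intro exI[of _ "Suc m"] exI[of _ "d(m := n)"] exI[of _ "r(m := s)"] conjI)
    then show False using max[of "k + n\<^sup>2"] n by simp
  qed
  moreover have "(\<Sum>i<m. (d i)\<^sup>2) \<le> card (carrier G)"
    using orthonormal_on_card_le[OF fin finite_coefficient_index[OF sys]
          orthonormal_coefficient_family[OF grp fin sys]] card_coefficient_index[OF sys] by simp
  ultimately have "complete_system G {..<m} (\<lambda>i. {..<d i}) r"
    using sys by (simp add: complete_system_def)
  then show ?thesis by (rule that)
qed

section \<open>Complete systems and the multiset of irreducible degrees\<close>

lemma subspace_vec_iff:
  "VectorSpace.subspace class_ring W (module_vec TYPE(complex) n) \<longleftrightarrow>
    W \<subseteq> carrier_vec n \<and> 0\<^sub>v n \<in> W \<and> (\<forall>v\<in>W. \<forall>w\<in>W. v + w \<in> W) \<and> (\<forall>c. \<forall>v\<in>W. c \<cdot>\<^sub>v v \<in> W)"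
  unfolding VectorSpace.subspace_def submodule_def
  using vec_vs[where 'a = complex, of n] vec_module[where 'a = complex, of n]
  by (auto simp: module_vec_simps class_ring_simps)

lemma representationD:
  assumes grp: "group G" and rep: "representation G (n, \<rho>)"
  shows "\<And>g. g \<in> carrier G \<Longrightarrow> \<rho> g \<in> carrier_mat n n"
    and "\<And>g h. g \<in> carrier G \<Longrightarrow> h \<in> carrier G \<Longrightarrow> \<rho> (g \<otimes>\<^bsub>G\<^esub> h) = \<rho> g * \<rho> h"
    and "\<rho> \<one>\<^bsub>G\<^esub> = 1\<^sub>m n"
proof -
  let ?R = "ring_mat TYPE(complex) n ()"
  interpret R: ring ?R by (rule ring_mat)
  have hom: "\<rho> \<in> hom G (units_of ?R)" using rep by (simp add: representation_def)
  show "\<rho> g \<in> carrier_mat n n" if "g \<in> carrier G" for g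
    using hom that by (auto simp: hom_def units_of_carrier Units_def ring_mat_simps Pi_iff)
  show "\<rho> (g \<otimes>\<^bsub>G\<^esub> h) = \<rho> g * \<rho> h" if "g \<in> carrier G" "h \<in> carrier G" for g h
    using hom that by (simp add: hom_def units_of_mult ring_mat_simps)
  show "\<rho> \<one>\<^bsub>G\<^esub> = 1\<^sub>m n"
    using hom_one[OF hom grp R.units_group] by (simp add: units_of_one ring_mat_simps)
qed

lemma representationI:
  assumes grp: "group G"
    and carr: "\<And>g. g \<in> carrier G \<Longrightarrow> \<rho> g \<in> carrier_mat n n"
    and mult: "\<And>g h. g \<in> carrier G \<Longrightarrow> h \<in> carrier G \<Longrightarrow> \<rho> (g \<otimes>\<^bsub>G\<^esub> h) = \<rho> g * \<rho> h"
    and one: "\<rho> \<one>\<^bsub>G\<^esub> = 1\<^sub>m n"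
  shows "representation G (n, \<rho>)"
proof -
  interpret group G by fact
  let ?R = "ring_mat TYPE(complex) n ()"
  have "\<rho> g \<in> Units ?R" if g: "g \<in> carrier G" for g
  proof -
    have "\<rho> g * \<rho> (inv\<^bsub>G\<^esub> g) = 1\<^sub>m n" "\<rho> (inv\<^bsub>G\<^esub> g) * \<rho> g = 1\<^sub>m n"
      using mult[of g "inv\<^bsub>G\<^esub> g"] mult[of "inv\<^bsub>G\<^esub> g" g] g one by simp_all
    then show ?thesis
      using carr[OF g] carr[OF inv_closed[OF g]] by (auto simp: Units_def ring_mat_simps)
  qed
  then show ?thesis
    using mult by (auto simp: representation_def hom_def units_of_carrier units_of_mult ring_mat_simps)
qed

lemma invertible_matE:
  assumes "P \<in> carrier_mat n n" "invertible_mat P"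
  obtains B where "B \<in> carrier_mat n n" "P * B = 1\<^sub>m n" "B * P = 1\<^sub>m n"
proof -
  from assms(2) obtain B where B: "P * B = 1\<^sub>m (dim_row P)" "B * P = 1\<^sub>m (dim_row B)"
    by (auto simp: invertible_mat_def inverts_mat_def)
  have "dim_row B = n" using B(2) assms(1) by (metis carrier_matD(2) index_mult_mat(3) index_one_mat(3))
  moreover have "dim_col B = n" using B(1) assms(1) by (metis carrier_matD(1) index_mult_mat(3) index_one_mat(3))
  ultimately show ?thesis using that[of B] B assms(1) by auto
qed

lemma invertible_matI:
  assumes "P \<in> carrier_mat n n" "B \<in> carrier_mat n n" "P * B = 1\<^sub>m n" "B * P = 1\<^sub>m n"
  shows "invertible_mat P"
  using assms by (auto simp: invertible_mat_def inverts_mat_def square_mat.simps intro!: exI[of _ B])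

text \<open>Preimages of the unit vectors form a right inverse \<open>B\<close>, and injectivity
  makes it a left inverse. Squareness then follows from traces: n = tr(TB) = tr(BT) = m.\<close>

lemma mat_bijective_square:
  fixes T :: "complex mat"
  assumes T: "T \<in> carrier_mat n m"
    and inj: "\<And>v. v \<in> carrier_vec m \<Longrightarrow> T *\<^sub>v v = 0\<^sub>v n \<Longrightarrow> v = 0\<^sub>v m"
    and surj: "\<And>w. w \<in> carrier_vec n \<Longrightarrow> \<exists>v\<in>carrier_vec m. T *\<^sub>v v = w"
  shows "n = m \<and> invertible_mat T"
proof -
  obtain b where b: "\<And>i. i < n \<Longrightarrow> b i \<in> carrier_vec m \<and> T *\<^sub>v b i = unit_vec n i"
    using surj[OF unit_vec_carrier] by metis
  define B where "B = mat m n (\<lambda>(j, i). b i $ j)"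
  have B: "B \<in> carrier_mat m n" by (simp add: B_def)
  have colB: "col B i = b i" if "i < n" for i
    using b[OF that] that by (intro eq_vecI) (auto simp: B_def)
  have TB: "T * B = 1\<^sub>m n"
  proof (rule eq_matI)
    fix i j assume "i < dim_row (1\<^sub>m n :: complex mat)" "j < dim_col (1\<^sub>m n :: complex mat)"
    then have ij: "i < n" "j < n" by auto
    have "(T * B) $$ (i, j) = (T *\<^sub>v col B j) $ i"
      using ij T B by simp
    then show "(T * B) $$ (i, j) = 1\<^sub>m n $$ (i, j)"
      using ij b[OF ij(2)] by (simp add: colB)
  qed (use T B in auto)
  have BT: "B * T = 1\<^sub>m m"
  proof -
    \<comment> \<open>T(BT - 1) = (TB)T - T = 0, so injectivity annihilates every value of BT -
      1.\<close>
    have "(B * T - 1\<^sub>m m) *\<^sub>v v = 0\<^sub>v m" if v: "v \<in> carrier_vec m" for v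
    proof (rule inj)
      have "T * (B * T - 1\<^sub>m m) = T * (B * T) - T * 1\<^sub>m m"
        using T B by (intro mult_minus_distrib_mat) auto
      also have "T * (B * T) = T * B * T" using T B by simp
      also have "\<dots> - T * 1\<^sub>m m = 0\<^sub>m n m" using T TB by simp
      finally have "T * (B * T - 1\<^sub>m m) = 0\<^sub>m n m" .
      then show "T *\<^sub>v ((B * T - 1\<^sub>m m) *\<^sub>v v) = 0\<^sub>v n"
        using T B v by (subst assoc_mult_mat_vec[symmetric]) auto
    next
      show "(B * T - 1\<^sub>m m) *\<^sub>v v \<in> carrier_vec m"
        using T B v by (intro mult_mat_vec_carrier[of _ m m]) auto
    qed
    then have z: "(B * T - 1\<^sub>m m) *\<^sub>v v = 0\<^sub>v m" if "v \<in> carrier_vec m" for v using that by blast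
    define C where "C = B * T - 1\<^sub>m m"
    have C: "C \<in> carrier_mat m m" using T B by (auto simp: C_def)
    have "C = 0\<^sub>m m m"
    proof (rule eq_matI)
      fix i j assume "i < dim_row (0\<^sub>m m m :: complex mat)" "j < dim_col (0\<^sub>m m m :: complex mat)"
      then have ij: "i < m" "j < m" by auto
      have "(C *\<^sub>v unit_vec m j) $ i = C $$ (i, j)" using ij C by simp
      then show "C $$ (i, j) = 0\<^sub>m m m $$ (i, j)"
        using z[of "unit_vec m j"] ij by (simp add: C_def)
    qed (use C in auto)
    moreover have "B * T = C + 1\<^sub>m m"
      using T B by (intro eq_matI) (auto simp: C_def)
    ultimately show ?thesis by simp
  qed
  have "of_nat n = (\<Sum>i<n. (T * B) $$ (i, i))" using TB by simp
  also have "\<dots> = (\<Sum>i<n. \<Sum>j<m. T $$ (i, j) * B $$ (j, i))"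
    using T B by (simp add: scalar_prod_def atLeast0LessThan)
  also have "\<dots> = (\<Sum>j<m. \<Sum>i<n. B $$ (j, i) * T $$ (i, j))"
    by (subst sum.swap) (simp add: mult.commute)
  also have "\<dots> = (\<Sum>j<m. (B * T) $$ (j, j))"
    using T B by (simp add: scalar_prod_def atLeast0LessThan)
  also have "\<dots> = (of_nat m :: complex)" using BT by simp
  finally have nm: "n = m" by simp
  then show ?thesis
    using invertible_matI[of T m B] T B TB BT by simp
qed

text \<open>Schur's lemma: the kernel and the image of \<open>T\<close> are invariant, so a nonzero
  \<open>T\<close> has zero kernel and full image.\<close>

lemma irreducible_intertwiner:
  assumes grp: "group G"
    and irr: "irreducible_representation G (n, \<rho>)" "irreducible_representation G (m, \<tau>)"
    and T: "T \<in> carrier_mat n m" and T0: "T \<noteq> 0\<^sub>m n m"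
    and int: "\<And>g. g \<in> carrier G \<Longrightarrow> \<rho> g * T = T * \<tau> g"
  shows "n = m" "invertible_mat T"
proof -
  have rho: "representation G (n, \<rho>)" and tau: "representation G (m, \<tau>)"
    using irr by (auto simp: irreducible_representation_def)
  note rhoD = representationD(1)[OF grp rho] and tauD = representationD(1)[OF grp tau]
  have T_vec: "T = 0\<^sub>m n m" if "\<And>v. v \<in> carrier_vec m \<Longrightarrow> T *\<^sub>v v = 0\<^sub>v n"
  proof (rule eq_matI)
    fix i j assume "i < dim_row (0\<^sub>m n m :: complex mat)" "j < dim_col (0\<^sub>m n m :: complex mat)"
    then have ij: "i < n" "j < m" by auto
    have "(T *\<^sub>v unit_vec m j) $ i = T $$ (i, j)" using ij T by auto
    then show "T $$ (i, j) = 0\<^sub>m n m $$ (i, j)" using that[of "unit_vec m j"] ij by simp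
  qed (use T in auto)
  have comm: "\<rho> g *\<^sub>v (T *\<^sub>v v) = T *\<^sub>v (\<tau> g *\<^sub>v v)" if "g \<in> carrier G" "v \<in> carrier_vec m" for g v
    using int[OF that(1)] rhoD[OF that(1)] tauD[OF that(1)] T that(2)
    by (metis assoc_mult_mat_vec)
  define ker where "ker = {v \<in> carrier_vec m. T *\<^sub>v v = 0\<^sub>v n}"
  have "VectorSpace.subspace class_ring ker (module_vec TYPE(complex) m)"
    unfolding subspace_vec_iff ker_def using T
    by (auto simp: mult_add_distrib_mat_vec mult_mat_vec)
  moreover have "\<tau> g *\<^sub>v v \<in> ker" if "g \<in> carrier G" "v \<in> ker" for g v
  proof -
    have "\<rho> g *\<^sub>v 0\<^sub>v n = 0\<^sub>v n" using rhoD[OF that(1)] by (intro eq_vecI) auto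
    then show ?thesis using that comm[of g v] tauD[of g] by (auto simp: ker_def)
  qed
  ultimately have "ker = {0\<^sub>v m} \<or> ker = carrier_vec m"
    using irr(2) by (auto simp: irreducible_representation_def)
  moreover have "ker \<noteq> carrier_vec m" using T_vec T0 by (auto simp: ker_def)
  ultimately have inj: "v = 0\<^sub>v m" if "v \<in> carrier_vec m" "T *\<^sub>v v = 0\<^sub>v n" for v
    using that by (auto simp: ker_def)
  define im where "im = {T *\<^sub>v v | v. v \<in> carrier_vec m}"
  have "VectorSpace.subspace class_ring im (module_vec TYPE(complex) n)"
    unfolding subspace_vec_iff
  proof (intro conjI ballI allI)
    show "im \<subseteq> carrier_vec n" using T by (auto simp: im_def)
    show "0\<^sub>v n \<in> im" using T by (auto simp: im_def intro!: exI[of _ "0\<^sub>v m"])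
    show "v + w \<in> im" if "v \<in> im" "w \<in> im" for v w
    proof -
      obtain v' w' where "v' \<in> carrier_vec m" "w' \<in> carrier_vec m" "v = T *\<^sub>v v'" "w = T *\<^sub>v w'"
        using \<open>v \<in> im\<close> \<open>w \<in> im\<close> by (auto simp: im_def)
      then show ?thesis
        using T by (auto simp: im_def mult_add_distrib_mat_vec[symmetric])
    qed
    show "c \<cdot>\<^sub>v v \<in> im" if "v \<in> im" for c v
    proof -
      obtain v' where "v' \<in> carrier_vec m" "v = T *\<^sub>v v'"
        using \<open>v \<in> im\<close> by (auto simp: im_def)
      then show ?thesis using T by (auto simp: im_def mult_mat_vec[symmetric])
    qed
  qed
  moreover have "\<rho> g *\<^sub>v v \<in> im" if "g \<in> carrier G" "v \<in> im" for g v
    using that comm[of g] tauD[of g] by (auto simp: im_def)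
  ultimately have "im = {0\<^sub>v n} \<or> im = carrier_vec n"
    using irr(1) by (auto simp: irreducible_representation_def)
  moreover have "im \<noteq> {0\<^sub>v n}" using T_vec T0 by (auto simp: im_def)
  ultimately have im: "im = carrier_vec n" by blast
  have "\<exists>v\<in>carrier_vec m. T *\<^sub>v v = w" if "w \<in> carrier_vec n" for w
  proof -
    have "w \<in> im" using that im by simp
    then show ?thesis by (auto simp: im_def)
  qed
  from mat_bijective_square[OF T inj this] show "n = m" "invertible_mat T" by auto
qed

section \<open>Complete systems as sets of representatives of the irreducible classes\<close>

definition matrix_rep :: "nat \<Rightarrow> ('a \<Rightarrow> nat \<Rightarrow> nat \<Rightarrow> complex) \<Rightarrow> 'a \<Rightarrow> complex mat" where
  "matrix_rep n r g = mat n n (\<lambda>(a, b). r g a b)"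

lemma matrix_rep_carrier [simp]: "matrix_rep n r g \<in> carrier_mat n n"
  by (simp add: matrix_rep_def)

lemma matrix_rep_index [simp]: "a < n \<Longrightarrow> b < n \<Longrightarrow> matrix_rep n r g $$ (a, b) = r g a b"
  by (simp add: matrix_rep_def)

lemma matrix_rep_dims [simp]: "dim_row (matrix_rep n r g) = n" "dim_col (matrix_rep n r g) = n"
  by (simp_all add: matrix_rep_def)

lemma representation_matrix_rep:
  assumes grp: "group G" and r: "unitary_rep G {..<n} r"
  shows "representation G (n, matrix_rep n r)"
proof (rule representationI[OF grp])
  show "matrix_rep n r (g \<otimes>\<^bsub>G\<^esub> h) = matrix_rep n r g * matrix_rep n r h"
    if "g \<in> carrier G" "h \<in> carrier G" for g h
    using unitary_repD(2)[OF r that]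
    by (intro eq_matI) (simp_all add: scalar_prod_def atLeast0LessThan)
  show "matrix_rep n r \<one>\<^bsub>G\<^esub> = 1\<^sub>m n"
    using unitary_repD(3)[OF r] by (intro eq_matI) auto
qed simp

text \<open>As in Burnside's theorem, orthogonality of the coefficients makes the matrices of the
  representation span the full matrix algebra. An invariant subspace containing a nonzero vector
  \<open>w\<close> therefore contains every vector.\<close>

lemma irreducible_orthogonal_system:
  assumes grp: "group G" and fin: "finite (carrier G)"
    and sys: "orthogonal_system G I (\<lambda>i. {..<d i}) r" and i: "i \<in> I"
  shows "irreducible_representation G (d i, matrix_rep (d i) (r i))"
proof -
  interpret group G by fact
  let ?n = "d i" and ?M = "matrix_rep (d i) (r i)"
  have n: "?n > 0" using orthogonal_systemD(5)[OF sys i] by simp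
  have N: "card (carrier G) > 0" using fin one_closed by (auto simp: card_gt_0_iff)
  have "W = {0\<^sub>v ?n} \<or> W = carrier_vec ?n"
    if sub: "VectorSpace.subspace class_ring W (module_vec TYPE(complex) ?n)"
      and inv: "\<And>g w. g \<in> carrier G \<Longrightarrow> w \<in> W \<Longrightarrow> ?M g *\<^sub>v w \<in> W" for W
  proof (cases "W = {0\<^sub>v ?n}")
    case False
    have W: "W \<subseteq> carrier_vec ?n" "0\<^sub>v ?n \<in> W" "\<And>v w. v \<in> W \<Longrightarrow> w \<in> W \<Longrightarrow> v + w \<in> W"
      "\<And>c v. v \<in> W \<Longrightarrow> c \<cdot>\<^sub>v v \<in> W"
      using sub by (auto simp: subspace_vec_iff)
    obtain w where w: "w \<in> W" "w \<noteq> 0\<^sub>v ?n" using W(2) False by blast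
    have wn: "w \<in> carrier_vec ?n" using W(1) w(1) by blast
    obtain b where b: "b < ?n" "w $ b \<noteq> 0"
    proof (rule ccontr)
      assume "\<not> thesis"
      then have "w = 0\<^sub>v ?n" using wn that by (intro eq_vecI) auto
      with w(2) show False ..
    qed
    \<comment> \<open>An invariant subspace is stable under the whole group algebra; spelling the
      combination out by coordinates prepares the comparison with \<open>v\<close>.\<close>
    have comb: "vec ?n (\<lambda>e. \<Sum>g\<in>F. c g * (?M g *\<^sub>v w) $ e) \<in> W" if "F \<subseteq> carrier G" "finite F" for F c
      using that(2,1)
    proof (induction F rule: finite_induct)
      case empty
      have "vec ?n (\<lambda>e. 0) = (0\<^sub>v ?n :: complex vec)" by (intro eq_vecI) auto
      then show ?case using W(2) by simp
    next
      case (insert g F)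
      have "vec ?n (\<lambda>e. \<Sum>g\<in>insert g F. c g * (?M g *\<^sub>v w) $ e)
        = c g \<cdot>\<^sub>v (?M g *\<^sub>v w) + vec ?n (\<lambda>e. \<Sum>g\<in>F. c g * (?M g *\<^sub>v w) $ e)"
        using insert.hyps by (intro eq_vecI) auto
      then show ?case
        using insert W(3,4) inv w(1) by simp
    qed
    have "v \<in> W" if v: "v \<in> carrier_vec ?n" for v
    proof -
      \<comment> \<open>By Schur orthogonality this combination of the operators \<open>?M g\<close> is the rank-one operator
        sending \<open>w\<close> to \<open>v\<close>.\<close>
      define k where "k = of_nat ?n / of_nat (card (carrier G)) / w $ b"
      define c where "c = (\<lambda>g. k * (\<Sum>a<?n. v $ a * cnj (r i g a b)))"
      have "(\<Sum>g\<in>carrier G. c g * (?M g *\<^sub>v w) $ e) = v $ e" if e: "e < ?n" for e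
      proof -
        have "(\<Sum>g\<in>carrier G. c g * (?M g *\<^sub>v w) $ e) = (\<Sum>g\<in>carrier G. c g * (\<Sum>f<?n. r i g e f * w $ f))"
          using e wn by (simp add: scalar_prod_def atLeast0LessThan)
        also have "\<dots> = k * (\<Sum>g\<in>carrier G. (\<Sum>a<?n. v $ a * cnj (r i g a b)) * (\<Sum>f<?n. r i g e f * w $ f))"
          unfolding c_def by (subst sum_distrib_left) (simp only: mult.assoc)
        also have "(\<Sum>g\<in>carrier G. (\<Sum>a<?n. v $ a * cnj (r i g a b)) * (\<Sum>f<?n. r i g e f * w $ f))
          = (\<Sum>g\<in>carrier G. \<Sum>a<?n. \<Sum>f<?n. v $ a * w $ f * (r i g e f * cnj (r i g a b)))"
          unfolding sum_product by (intro sum.cong refl) (simp add: mult_ac)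
        also have "\<dots> = (\<Sum>a<?n. \<Sum>f<?n. \<Sum>g\<in>carrier G. v $ a * w $ f * (r i g e f * cnj (r i g a b)))"
          by (subst sum.swap, intro sum.cong refl, rule sum.swap)
        also have "\<dots> = (\<Sum>a<?n. \<Sum>f<?n. v $ a * w $ f * inner_on (carrier G) (\<lambda>g. r i g e f) (\<lambda>g. r i g a b))"
          by (simp add: inner_on_def sum_distrib_left)
        also have "\<dots> = (\<Sum>a<?n. \<Sum>f<?n. if f = b then if a = e then
            v $ a * w $ f * (of_nat (card (carrier G)) / of_nat ?n) else 0 else 0)"
          using orthogonal_systemD(6)[OF sys i i] e b(1) by (intro sum.cong refl) auto
        also have "\<dots> = v $ e * w $ b * (of_nat (card (carrier G)) / of_nat ?n)"
          using e b(1) by simp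
        finally show ?thesis using b(2) n N by (simp add: k_def)
      qed
      then have "vec ?n (\<lambda>e. \<Sum>g\<in>carrier G. c g * (?M g *\<^sub>v w) $ e) = v"
        using v by (intro eq_vecI) auto
      then show ?thesis using comb[OF subset_refl fin, of c] by simp
    qed
    then show ?thesis using W(1) by blast
  qed simp
  then show ?thesis
    using representation_matrix_rep[OF grp orthogonal_systemD(3)[OF sys i]] n
    by (auto simp: irreducible_representation_def)
qed

text \<open>Pair the intertwining equation for \<open>P\<close>, at entry \<open>(a, a)\<close>,
  with the coefficient \<open>(e, a)\<close> of the representation \<open>i\<close>. Orthogonality
  kills the side of \<open>j\<close> and leaves a nonzero multiple of P(a, e) on the side of
  \<open>i\<close>, so an intertwiner between distinct members vanishes and cannot be
  invertible.\<close>

lemma inequivalent_orthogonal_system: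
  assumes grp: "group G" and fin: "finite (carrier G)"
    and sys: "orthogonal_system G I (\<lambda>i. {..<d i}) r" and ij: "i \<in> I" "j \<in> I"
    and eq: "equivalent_representations G (d i, matrix_rep (d i) (r i)) (d j, matrix_rep (d j) (r j))"
  shows "i = j"
proof (rule ccontr)
  assume "i \<noteq> j"
  interpret group G by fact
  have N: "card (carrier G) > 0" using fin one_closed by (auto simp: card_gt_0_iff)
  have n: "d i > 0" using orthogonal_systemD(5)[OF sys ij(1)] by simp
  from eq obtain P where dij: "d j = d i" and P: "P \<in> carrier_mat (d i) (d i)" "invertible_mat P"
    and comm: "\<And>g. g \<in> carrier G \<Longrightarrow> P * matrix_rep (d i) (r i) g = matrix_rep (d j) (r j) g * P"
    by (auto simp: equivalent_representations_def)
  have entry: "(\<Sum>c<d i. P $$ (a, c) * r i g c b) = (\<Sum>c<d i. r j g a c * P $$ (c, b))"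
    if "g \<in> carrier G" "a < d i" "b < d i" for g a b
    using arg_cong[OF comm[OF that(1)], of "\<lambda>M. M $$ (a, b)"] that(2,3) P(1) dij
    by (simp add: scalar_prod_def atLeast0LessThan)
  have "P $$ (a, e) = 0" if ae: "a < d i" "e < d i" for a e
  proof -
    have "(\<Sum>c<d i. P $$ (a, c) * inner_on (carrier G) (\<lambda>g. r i g c a) (\<lambda>g. r i g e a))
      = (\<Sum>g\<in>carrier G. (\<Sum>c<d i. P $$ (a, c) * r i g c a) * cnj (r i g e a))"
      unfolding inner_on_def sum_distrib_left sum_distrib_right by (subst sum.swap) (simp add: mult_ac)
    also have "\<dots> = (\<Sum>g\<in>carrier G. (\<Sum>c<d i. r j g a c * P $$ (c, a)) * cnj (r i g e a))"
      using entry ae by simp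
    also have "\<dots> = (\<Sum>c<d i. P $$ (c, a) * inner_on (carrier G) (\<lambda>g. r j g a c) (\<lambda>g. r i g e a))"
      unfolding inner_on_def sum_distrib_left sum_distrib_right by (subst sum.swap) (simp add: mult_ac)
    also have "\<dots> = 0"
      using orthogonal_systemD(6)[OF sys ij(2,1)] \<open>i \<noteq> j\<close> ae dij by simp
    finally have "(\<Sum>c<d i. P $$ (a, c) * inner_on (carrier G) (\<lambda>g. r i g c a) (\<lambda>g. r i g e a)) = 0" .
    moreover have "(\<Sum>c<d i. P $$ (a, c) * inner_on (carrier G) (\<lambda>g. r i g c a) (\<lambda>g. r i g e a))
      = (\<Sum>c<d i. if c = e then P $$ (a, c) * (of_nat (card (carrier G)) / of_nat (d i)) else 0)"
      using orthogonal_systemD(6)[OF sys ij(1,1)] ae by (intro sum.cong refl) auto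
    ultimately show ?thesis using ae N n by simp
  qed
  then have P0: "P = 0\<^sub>m (d i) (d i)" using P(1) by (intro eq_matI) auto
  obtain B where PB: "P * B = 1\<^sub>m (d i)" and B: "B \<in> carrier_mat (d i) (d i)"
    using invertible_matE[OF P] by blast
  have "(P * B) $$ (0, 0) = 1" using PB n by simp
  then show False using n B by (simp add: P0 scalar_prod_def)
qed


text \<open>If \<rho> were equivalent to no member, every averaged intertwiner would vanish by
  Schur's lemma. The coefficients of \<rho> would then be orthogonal to a complete orthonormal
  family and hence zero, although \<rho> is the identity matrix at the identity element.\<close>

lemma irreducible_in_complete_system:
  assumes grp: "group G" and fin: "finite (carrier G)"
    and complete: "complete_system G I (\<lambda>i. {..<d i}) r"
    and irr: "irreducible_representation G (n, \<rho>)"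
  obtains i where "i \<in> I" "equivalent_representations G (d i, matrix_rep (d i) (r i)) (n, \<rho>)"
proof (rule ccontr)
  note witness = that
  assume no: "\<not> thesis"
  have none: "\<not> equivalent_representations G (d i, matrix_rep (d i) (r i)) (n, \<rho>)" if "i \<in> I" for i
    using witness[OF that] no by blast
  interpret group G by fact
  have sys: "orthogonal_system G I (\<lambda>i. {..<d i}) r" using complete by (simp add: complete_system_def)
  have rep: "representation G (n, \<rho>)" and n: "n > 0"
    using irr by (auto simp: irreducible_representation_def)
  note repD = representationD[OF grp rep]
  have orth: "(\<Sum>g\<in>carrier G. \<rho> g $$ (a, b) * cnj (r i g c e)) = 0"
    if i: "i \<in> I" and mem: "a < n" "b < n" "c < d i" "e < d i" for i a b c e
  proof -
    define T where "T = mat n (d i) (\<lambda>(a, c). \<Sum>g\<in>carrier G. \<rho> g $$ (a, b) * cnj (r i g c e))"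
    have T: "T \<in> carrier_mat n (d i)" by (simp add: T_def)
    have hom: "\<rho> (g \<otimes>\<^bsub>G\<^esub> h) $$ (a, c) = (\<Sum>e<n. \<rho> g $$ (a, e) * \<rho> h $$ (e, c))"
      if "g \<in> carrier G" "h \<in> carrier G" "a \<in> {..<n}" "c \<in> {..<n}" for g h a c
      using repD(1)[OF that(1)] repD(1)[OF that(2)] that(3,4)
      by (simp add: repD(2)[OF that(1,2)] scalar_prod_def atLeast0LessThan)
    have "\<rho> h * T = T * matrix_rep (d i) (r i) h" if h: "h \<in> carrier G" for h
    proof (rule eq_matI)
      fix a c assume "a < dim_row (T * matrix_rep (d i) (r i) h)" "c < dim_col (T * matrix_rep (d i) (r i) h)"
      then have ac: "a < n" "c < d i" using T by auto
      have "(\<rho> h * T) $$ (a, c) = (\<Sum>f<n. \<rho> h $$ (a, f) * (\<Sum>g\<in>carrier G. \<rho> g $$ (f, b) * cnj (r i g c e)))"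
        using repD(1)[OF h] ac by (simp add: T_def scalar_prod_def atLeast0LessThan)
      also have "\<dots> = (\<Sum>f<d i. (\<Sum>g\<in>carrier G. \<rho> g $$ (a, b) * cnj (r i g f e)) * r i h f c)"
        by (rule averaged_intertwiner[OF grp orthogonal_systemD(3)[OF sys i],
            where r = "\<lambda>g a b. \<rho> g $$ (a, b)"]) (use hom mem ac h in auto)
      also have "\<dots> = (T * matrix_rep (d i) (r i) h) $$ (a, c)"
        using ac by (simp add: T_def scalar_prod_def atLeast0LessThan)
      finally show "(\<rho> h * T) $$ (a, c) = (T * matrix_rep (d i) (r i) h) $$ (a, c)" .
    qed (use T repD(1)[OF h] in auto)
    note int = irreducible_intertwiner[OF grp irr irreducible_orthogonal_system[OF grp fin sys i] T _ this]
    have "T = 0\<^sub>m n (d i)"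
    proof (rule ccontr)
      assume "T \<noteq> 0\<^sub>m n (d i)"
      from int[OF this] have "n = d i" "invertible_mat T" by auto
      then have "equivalent_representations G (d i, matrix_rep (d i) (r i)) (n, \<rho>)"
        using T \<open>\<And>h. h \<in> carrier G \<Longrightarrow> \<rho> h * T = T * matrix_rep (d i) (r i) h\<close>
        by (auto simp: equivalent_representations_def intro!: bexI[of _ T])
      with none[OF i] show False ..
    qed
    then have "T $$ (a, c) = 0" using mem by simp
    then show ?thesis using mem by (simp add: T_def)
  qed
  let ?X = "coefficient_index I (\<lambda>i. {..<d i})" and ?u = "coefficient_family G (\<lambda>i. {..<d i}) r"
  have "card ?X = card (carrier G)"
    using complete card_coefficient_index[OF sys] by (simp add: complete_system_def)
  \<comment> \<open>Entry (0, 0) exists because \<open>n\<close> is positive, and its value at the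
    identity is 1; the expansion will make it 0.\<close>
  then have "\<rho> \<one>\<^bsub>G\<^esub> $$ (0, 0) = (\<Sum>x\<in>?X. inner_on (carrier G) (\<lambda>g. \<rho> g $$ (0, 0)) (?u x) * ?u x \<one>\<^bsub>G\<^esub>)"
    by (intro orthonormal_on_expansion fin finite_coefficient_index[OF sys]
        orthonormal_coefficient_family[OF grp fin sys] one_closed)
  also have "\<dots> = 0"
  proof (intro sum.neutral ballI)
    fix x assume "x \<in> ?X"
    then obtain i a b where x: "x = (i, a, b)" and mem: "i \<in> I" "a < d i" "b < d i"
      by (auto simp: coefficient_index_def)
    show "inner_on (carrier G) (\<lambda>g. \<rho> g $$ (0, 0)) (?u x) * ?u x \<one>\<^bsub>G\<^esub> = 0"
      using orth[OF mem(1) n n mem(2,3)]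
      by (simp add: x coefficient_family_def inner_on_scale_right) (simp add: inner_on_def)
  qed
  finally show False using n by (simp add: repD(3))
qed

lemma equivalent_representations_sym:
  assumes grp: "group G" and rep: "representation G (n, \<rho>)" "representation G (m, \<tau>)"
    and eq: "equivalent_representations G (n, \<rho>) (m, \<tau>)"
  shows "equivalent_representations G (m, \<tau>) (n, \<rho>)"
proof -
  from eq obtain P where nm: "n = m" and P: "P \<in> carrier_mat n n" "invertible_mat P"
    and comm: "\<And>g. g \<in> carrier G \<Longrightarrow> P * \<rho> g = \<tau> g * P"
    by (auto simp: equivalent_representations_def)
  obtain B where B: "B \<in> carrier_mat n n" and PB: "P * B = 1\<^sub>m n" and BP: "B * P = 1\<^sub>m n"
    using invertible_matE[OF P] by blast
  have "B * \<tau> g = \<rho> g * B" if g: "g \<in> carrier G" for g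
  proof -
    have r: "\<rho> g \<in> carrier_mat n n" and t: "\<tau> g \<in> carrier_mat n n"
      using representationD(1)[OF grp rep(1) g] representationD(1)[OF grp rep(2) g] nm by auto
    have "B * \<tau> g = B * (\<tau> g * (P * B))" using t by (simp add: PB)
    also have "\<dots> = B * ((\<tau> g * P) * B)" using t P(1) B by simp
    also have "\<dots> = B * ((P * \<rho> g) * B)" by (simp add: comm[OF g])
    also have "\<dots> = (B * P) * (\<rho> g * B)" using r P(1) B by (simp add: assoc_mult_mat[of _ n n _ n _ n])
    also have "\<dots> = \<rho> g * B" using r B by (simp add: BP)
    finally show ?thesis .
  qed
  moreover have "invertible_mat B"
    using invertible_matI[OF B P(1) BP PB] .
  ultimately show ?thesis using nm B by (auto simp: equivalent_representations_def)
qed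

lemma equivalent_representations_trans:
  assumes grp: "group G"
    and rep: "representation G (n, \<rho>)" "representation G (m, \<tau>)" "representation G (l, \<omega>)"
    and eq: "equivalent_representations G (n, \<rho>) (m, \<tau>)" "equivalent_representations G (m, \<tau>) (l, \<omega>)"
  shows "equivalent_representations G (n, \<rho>) (l, \<omega>)"
proof -
  from eq(1) obtain P where nm: "n = m" and P: "P \<in> carrier_mat n n" "invertible_mat P"
    and comm: "\<And>g. g \<in> carrier G \<Longrightarrow> P * \<rho> g = \<tau> g * P"
    by (auto simp: equivalent_representations_def)
  from eq(2) obtain Q where ml: "m = l" and Q: "Q \<in> carrier_mat n n" "invertible_mat Q"
    and comm': "\<And>g. g \<in> carrier G \<Longrightarrow> Q * \<tau> g = \<omega> g * Q"
    using nm by (auto simp: equivalent_representations_def)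
  have "(Q * P) * \<rho> g = \<omega> g * (Q * P)" if g: "g \<in> carrier G" for g
  proof -
    have c: "\<rho> g \<in> carrier_mat n n" "\<tau> g \<in> carrier_mat n n" "\<omega> g \<in> carrier_mat n n"
      using representationD(1)[OF grp rep(1) g] representationD(1)[OF grp rep(2) g]
        representationD(1)[OF grp rep(3) g] nm ml by auto
    have "(Q * P) * \<rho> g = Q * (P * \<rho> g)" using c P(1) Q(1) by simp
    also have "\<dots> = (Q * \<tau> g) * P" using c P(1) Q(1) by (simp add: comm[OF g])
    also have "\<dots> = \<omega> g * (Q * P)" using c P(1) Q(1) by (simp add: comm'[OF g])
    finally show ?thesis .
  qed
  moreover have "invertible_mat (Q * P)"
  proof -
    obtain B where B: "B \<in> carrier_mat n n" "P * B = 1\<^sub>m n" "B * P = 1\<^sub>m n"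
      using invertible_matE[OF P] by blast
    obtain C where C: "C \<in> carrier_mat n n" "Q * C = 1\<^sub>m n" "C * Q = 1\<^sub>m n"
      using invertible_matE[OF Q] by blast
    have "(Q * P) * (B * C) = Q * ((P * B) * C)"
      using P(1) Q(1) B(1) C(1) by (simp add: assoc_mult_mat[of _ n n _ n _ n])
    then have 1: "(Q * P) * (B * C) = 1\<^sub>m n" using B C by simp
    have "(B * C) * (Q * P) = B * ((C * Q) * P)"
      using P(1) Q(1) B(1) C(1) by (simp add: assoc_mult_mat[of _ n n _ n _ n])
    then have 2: "(B * C) * (Q * P) = 1\<^sub>m n" using B C P(1) by simp
    show ?thesis
      using P(1) Q(1) B(1) C(1) by (intro invertible_matI[OF _ _ 1 2]) auto
  qed
  ultimately show ?thesis using nm ml P(1) Q(1) by (auto simp: equivalent_representations_def)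
qed


text \<open>Sending \<open>i\<close> to the class of its matrix representation is a bijection from
  \<open>I\<close> to the irreducible classes: onto because every irreducible representation meets
  the system, injective because distinct members are inequivalent. This ties the construction to the
  degrees in the hypothesis.\<close>

theorem irrep_degrees_complete_system:
  assumes grp: "group G" and fin: "finite (carrier G)" and complete: "complete_system G I (\<lambda>i. {..<d i}) r"
  shows "irrep_degrees G = image_mset d (mset_set I)"
proof -
  have sys: "orthogonal_system G I (\<lambda>i. {..<d i}) r" using complete by (simp add: complete_system_def)
  define E where "E = {(\<rho>, \<tau>). irreducible_representation G \<rho> \<and> irreducible_representation G \<tau> \<and>
    equivalent_representations G \<rho> \<tau>}"
  define R where "R = (\<lambda>i. (d i, matrix_rep (d i) (r i)))"
  define C where "C = (\<lambda>i. E `` {R i})"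
  have rep: "representation G \<rho>" if "irreducible_representation G \<rho>" for \<rho>
    using that by (auto simp: irreducible_representation_def split: prod.splits)
  have irrR: "irreducible_representation G (R i)" if "i \<in> I" for i
    unfolding R_def by (rule irreducible_orthogonal_system[OF grp fin sys that])
  have sym: "(\<tau>, \<rho>) \<in> E" if "(\<rho>, \<tau>) \<in> E" for \<rho> \<tau>
    using that rep equivalent_representations_sym[OF grp, of "fst \<rho>" "snd \<rho>" "fst \<tau>" "snd \<tau>"]
    by (auto simp: E_def)
  have trans: "(\<rho>, \<omega>) \<in> E" if "(\<rho>, \<tau>) \<in> E" "(\<tau>, \<omega>) \<in> E" for \<rho> \<tau> \<omega>
    using that rep equivalent_representations_trans[OF grp, of "fst \<rho>" "snd \<rho>" "fst \<tau>" "snd \<tau>" "fst \<omega>" "snd \<omega>"]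
    by (auto simp: E_def)
  have hit: "\<exists>i\<in>I. (R i, \<rho>) \<in> E" if irr: "irreducible_representation G \<rho>" for \<rho>
  proof -
    obtain i where "i \<in> I" "equivalent_representations G (R i) (fst \<rho>, snd \<rho>)"
      using irreducible_in_complete_system[OF grp fin complete, of "fst \<rho>" "snd \<rho>"] irr
      unfolding R_def by auto
    then show ?thesis using irr irrR by (auto simp: E_def)
  qed
  \<comment> \<open>\<open>R i\<close> is related to some member of the system; symmetry and
    transitivity then relate it to itself.\<close>
  have refl: "(R i, R i) \<in> E" if i: "i \<in> I" for i
    using hit[OF irrR[OF i]] sym trans by blast
  have "irrep_classes G = C ` I"
  proof
    show "irrep_classes G \<subseteq> C ` I"
    proof
      fix c assume "c \<in> irrep_classes G"
      then obtain \<rho> where irr: "irreducible_representation G \<rho>" and c: "c = E `` {\<rho>}"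
        by (auto simp: irrep_classes_def E_def quotient_def)
      obtain i where i: "i \<in> I" "(R i, \<rho>) \<in> E" using hit[OF irr] by blast
      have "c = C i" unfolding c C_def using i(2) sym trans by blast
      with i(1) show "c \<in> C ` I" by blast
    qed
    show "C ` I \<subseteq> irrep_classes G"
      using irrR by (auto simp: irrep_classes_def E_def quotient_def C_def)
  qed
  moreover have "inj_on C I"
  proof (rule inj_onI)
    fix i j assume ij: "i \<in> I" "j \<in> I" "C i = C j"
    then have "(R i, R j) \<in> E" using refl[OF ij(2)] unfolding C_def by blast
    then have "equivalent_representations G (R i) (R j)" by (simp add: E_def)
    then show "i = j"
      unfolding R_def by (rule inequivalent_orthogonal_system[OF grp fin sys ij(1,2)])
  qed
  moreover have "the_elem (fst ` C i) = d i" if "i \<in> I" for i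
  proof -
    have "fst ` C i = {d i}"
      using refl[OF that] by (force simp: C_def E_def R_def equivalent_representations_def)
    then show ?thesis by simp
  qed
  ultimately have "irrep_degrees G = image_mset (\<lambda>c. the_elem (fst ` c)) (image_mset C (mset_set I))"
    by (simp add: irrep_degrees_def image_mset_mset_set)
  also have "\<dots> = image_mset d (mset_set I)"
    unfolding multiset.map_comp
    by (rule image_mset_cong)
      (use \<open>\<And>i. i \<in> I \<Longrightarrow> the_elem (fst ` C i) = d i\<close> orthogonal_systemD(1)[OF sys] in simp)
  finally show ?thesis .
qed

section \<open>Renumbering, transport and products of complete systems\<close>

lemma orthogonal_system_reindex:
  assumes sys: "orthogonal_system G I S r" and f: "\<And>i. i \<in> I \<Longrightarrow> bij_betw (f i) (T i) (S i)"
  shows "orthogonal_system G I T (\<lambda>i g a b. r i g (f i a) (f i b))"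
  unfolding orthogonal_system_def
proof (intro conjI ballI)
  show "finite I" by (rule orthogonal_systemD(1)[OF sys])
next
  fix i assume i: "i \<in> I"
  show "T i \<noteq> {}" using f[OF i] orthogonal_systemD(2)[OF sys i] by (auto simp: bij_betw_def)
  show "unitary_rep G (T i) (\<lambda>g a b. r i g (f i a) (f i b))"
    by (rule unitary_rep_reindex[OF orthogonal_systemD(3)[OF sys i] f[OF i]])
next
  fix i j a b c d
  assume ij: "i \<in> I" "j \<in> I" and mem: "a \<in> T i" "b \<in> T i" "c \<in> T j" "d \<in> T j"
  have mem': "f i a \<in> S i" "f i b \<in> S i" "f j c \<in> S j" "f j d \<in> S j"
    using f ij mem by (auto dest: bij_betwE)
  have "i = j \<and> f i a = f j c \<and> f i b = f j d \<longleftrightarrow> i = j \<and> a = c \<and> b = d"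
    using f[OF ij(1)] mem by (auto simp: bij_betw_def dest: inj_onD)
  then show "inner_on (carrier G) (\<lambda>g. r i g (f i a) (f i b)) (\<lambda>g. r j g (f j c) (f j d))
    = (if i = j \<and> a = c \<and> b = d then of_nat (card (carrier G)) / of_nat (card (T i)) else 0)"
    by (simp only: orthogonal_systemD(6)[OF sys ij mem'] bij_betw_same_card[OF f[OF ij(1)]])
qed

text \<open>Matrices are indexed by naturals, while the representations of a direct product are
  indexed by pairs; renumbering each index set closes this gap.\<close>

lemma irrep_degrees_eq:
  assumes grp: "group G" and fin: "finite (carrier G)" and complete: "complete_system G I S r"
  shows "irrep_degrees G = image_mset (\<lambda>i. card (S i)) (mset_set I)"
proof -
  have sys: "orthogonal_system G I S r" using complete by (simp add: complete_system_def)
  have "\<exists>f. bij_betw f {..<card (S i)} (S i)" if "i \<in> I" for i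
    using ex_bij_betw_nat_finite[OF orthogonal_systemD(4)[OF sys that]] by (simp add: atLeast0LessThan)
  then obtain f where f: "\<And>i. i \<in> I \<Longrightarrow> bij_betw (f i) {..<card (S i)} (S i)" by metis
  have "complete_system G I (\<lambda>i. {..<card (S i)}) (\<lambda>i g a b. r i g (f i a) (f i b))"
    using orthogonal_system_reindex[where T = "\<lambda>i. {..<card (S i)}", OF sys f] complete
    by (simp add: complete_system_def)
  then show ?thesis by (rule irrep_degrees_complete_system[OF grp fin])
qed

lemma complete_system_reindex:
  assumes complete: "complete_system G I S r" and p: "bij_betw p J I"
  shows "complete_system G J (\<lambda>j. S (p j)) (\<lambda>j. r (p j))"
proof -
  have sys: "orthogonal_system G I S r" using complete by (simp add: complete_system_def)
  have pI: "p j \<in> I" if "j \<in> J" for j using p that by (auto dest: bij_betwE)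
  have inj: "p i = p j \<longleftrightarrow> i = j" if "i \<in> J" "j \<in> J" for i j
    using p that by (auto simp: bij_betw_def dest: inj_onD)
  have "orthogonal_system G J (\<lambda>j. S (p j)) (\<lambda>j. r (p j))"
    unfolding orthogonal_system_def
  proof (intro conjI ballI)
    show "finite J" using bij_betw_finite[OF p] orthogonal_systemD(1)[OF sys] by simp
  next
    fix j assume "j \<in> J"
    then show "S (p j) \<noteq> {}" "unitary_rep G (S (p j)) (r (p j))"
      by (rule orthogonal_systemD(2,3)[OF sys pI])+
  next
    fix i j a b c d
    assume "i \<in> J" "j \<in> J" "a \<in> S (p i)" "b \<in> S (p i)" "c \<in> S (p j)" "d \<in> S (p j)"
    then show "inner_on (carrier G) (\<lambda>g. r (p i) g a b) (\<lambda>g. r (p j) g c d)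
      = (if i = j \<and> a = c \<and> b = d then of_nat (card (carrier G)) / of_nat (card (S (p i))) else 0)"
      using orthogonal_systemD(6)[OF sys pI pI] inj by simp
  qed
  moreover have "(\<Sum>j\<in>J. (card (S (p j)))\<^sup>2) = (\<Sum>i\<in>I. (card (S i))\<^sup>2)"
    by (rule sum.reindex_bij_betw[OF p])
  ultimately show ?thesis using complete by (simp add: complete_system_def)
qed

lemma complete_system_iso:
  assumes grp: "group G" "group G'" and f: "f \<in> iso G' G" and complete: "complete_system G I S r"
  shows "complete_system G' I S (\<lambda>i g. r i (f g))"
proof -
  have sys: "orthogonal_system G I S r" using complete by (simp add: complete_system_def)
  have bij: "bij_betw f (carrier G') (carrier G)" using f by (simp add: iso_def)
  interpret group_hom G' G f
    using f grp by (auto simp: group_hom_def group_hom_axioms_def iso_def)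
  have rep: "unitary_rep G' (S i) (\<lambda>g. r i (f g))" if "i \<in> I" for i
    using unitary_repD[OF orthogonal_systemD(3)[OF sys that]] by (auto simp: unitary_rep_def)
  have inner: "inner_on (carrier G') (\<lambda>g. r i (f g) a b) (\<lambda>g. r j (f g) c d)
    = inner_on (carrier G) (\<lambda>g. r i g a b) (\<lambda>g. r j g c d)" for i j a b c d
    unfolding inner_on_def by (rule sum.reindex_bij_betw[OF bij])
  have "orthogonal_system G' I S (\<lambda>i g. r i (f g))"
    using rep sys by (auto simp: orthogonal_system_def inner bij_betw_same_card[OF bij])
  then show ?thesis using complete by (simp add: complete_system_def bij_betw_same_card[OF bij])
qed

lemma inner_on_Times:
  "inner_on (A \<times> B) (\<lambda>(x, y). f x * g y) (\<lambda>(x, y). f' x * g' y) = inner_on A f f' * inner_on B g g'"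
  unfolding inner_on_def sum_product sum.cartesian_product
  by (intro sum.cong refl) (auto simp: mult_ac)

text \<open>Tensor products of members: inner products over a product set factor, and so does the
  sum of squared degrees, so both orthogonality and the count are inherited.\<close>

lemma complete_system_DirProd:
  assumes grp: "group H" "group K" and complete: "complete_system H I S r" "complete_system K J T s"
  shows "complete_system (H \<times>\<times> K) (I \<times> J) (\<lambda>(i, j). S i \<times> T j)
    (\<lambda>(i, j) (h, k) (a, a') (b, b'). r i h a b * s j k a' b')"
proof -
  have sysH: "orthogonal_system H I S r" and sysK: "orthogonal_system K J T s"
    using complete by (auto simp: complete_system_def)
  let ?r = "\<lambda>(i, j) (h, k) (a, a') (b, b'). r i h a b * s j k a' b'"
  have rep: "unitary_rep (H \<times>\<times> K) (S i \<times> T j) (?r (i, j))" if ij: "i \<in> I" "j \<in> J" for i j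
  proof -
    note rH = unitary_repD[OF orthogonal_systemD(3)[OF sysH ij(1)]]
      and rK = unitary_repD[OF orthogonal_systemD(3)[OF sysK ij(2)]]
    have "(\<Sum>c\<in>S i. r i h a c * r i h' c b) * (\<Sum>c\<in>T j. s j k a' c * s j k' c b')
      = (\<Sum>(c, c')\<in>S i \<times> T j. r i h a c * s j k a' c' * (r i h' c b * s j k' c' b'))" for h h' k k' a b a' b'
      unfolding sum_product sum.cartesian_product by (intro sum.cong refl) (auto simp: mult_ac)
    then show ?thesis
      using rH rK grp unfolding unitary_rep_def
      by (auto simp: split_beta)
  qed
  have "inner_on (carrier (H \<times>\<times> K)) (\<lambda>g. ?r (i, j) g (a, a') (b, b')) (\<lambda>g. ?r (i', j') g (c, c') (d, d'))
    = inner_on (carrier H) (\<lambda>h. r i h a b) (\<lambda>h. r i' h c d) * inner_on (carrier K) (\<lambda>k. s j k a' b') (\<lambda>k. s j' k c' d')"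
    for i j i' j' a b c d a' b' c' d'
    by (subst inner_on_Times[symmetric]) (auto intro!: inner_on_cong)
  note inner = this[simplified]
  have "orthogonal_system (H \<times>\<times> K) (I \<times> J) (\<lambda>(i, j). S i \<times> T j) ?r"
    unfolding orthogonal_system_def
  proof (intro conjI ballI)
    show "finite (I \<times> J)" using orthogonal_systemD(1)[OF sysH] orthogonal_systemD(1)[OF sysK] by simp
  next
    fix x assume "x \<in> I \<times> J"
    then show "(case x of (i, j) \<Rightarrow> S i \<times> T j) \<noteq> {}" "unitary_rep (H \<times>\<times> K) (case x of (i, j) \<Rightarrow> S i \<times> T j) (?r x)"
      using orthogonal_systemD(2)[OF sysH] orthogonal_systemD(2)[OF sysK] rep by (auto simp del: split_paired_All)
  next
    fix x y a b c d
    assume xy: "x \<in> I \<times> J" "y \<in> I \<times> J"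
      and ab: "a \<in> (case x of (i, j) \<Rightarrow> S i \<times> T j)" "b \<in> (case x of (i, j) \<Rightarrow> S i \<times> T j)"
      and cd: "c \<in> (case y of (i, j) \<Rightarrow> S i \<times> T j)" "d \<in> (case y of (i, j) \<Rightarrow> S i \<times> T j)"
    obtain i j i' j' where x: "x = (i, j)" and y: "y = (i', j')" by (metis prod.exhaust)
    obtain a1 a2 b1 b2 c1 c2 d1 d2 where abcd: "a = (a1, a2)" "b = (b1, b2)" "c = (c1, c2)" "d = (d1, d2)"
      by (metis prod.exhaust)
    have mem: "i \<in> I" "i' \<in> I" "a1 \<in> S i" "b1 \<in> S i" "c1 \<in> S i'" "d1 \<in> S i'"
      and mem': "j \<in> J" "j' \<in> J" "a2 \<in> T j" "b2 \<in> T j" "c2 \<in> T j'" "d2 \<in> T j'"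
      using xy ab cd by (auto simp: x y abcd)
    show "inner_on (carrier (H \<times>\<times> K)) (\<lambda>g. ?r x g a b) (\<lambda>g. ?r y g c d)
      = (if x = y \<and> a = c \<and> b = d then of_nat (card (carrier (H \<times>\<times> K))) / of_nat (card (case x of (i, j) \<Rightarrow> S i \<times> T j)) else 0)"
      unfolding x y abcd using orthogonal_systemD(6)[OF sysH mem] orthogonal_systemD(6)[OF sysK mem']
      by (simp add: inner card_cartesian_product)
  qed
  moreover have "(\<Sum>x\<in>I \<times> J. (card (case x of (i, j) \<Rightarrow> S i \<times> T j))\<^sup>2)
    = (\<Sum>i\<in>I. (card (S i))\<^sup>2) * (\<Sum>j\<in>J. (card (T j))\<^sup>2)"
    unfolding sum_product sum.cartesian_product
    by (intro sum.cong refl) (auto simp: card_cartesian_product power_mult_distrib)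
  ultimately show ?thesis
    using complete by (simp add: complete_system_def card_cartesian_product)
qed

section \<open>Cancellation in products of multisets of degrees\<close>

definition product_mset :: "nat multiset \<Rightarrow> nat multiset \<Rightarrow> nat multiset" where
  "product_mset A B = (\<Sum>a\<in>#A. image_mset (\<lambda>b. a * b) B)"

lemma product_mset_add: "product_mset A (B + C) = product_mset A B + product_mset A C"
  by (simp add: product_mset_def sum_mset.distrib)

lemma set_product_mset: "set_mset (product_mset A B) = {a * b | a b. a \<in># A \<and> b \<in># B}"
  by (auto simp: product_mset_def)

lemma product_mset_index:
  assumes "finite I" "finite J"
  shows "image_mset (\<lambda>x. d (fst x) * e (snd x)) (mset_set (I \<times> J))
    = product_mset (image_mset d (mset_set I)) (image_mset e (mset_set J))"
  using assms(1)
proof (induction I rule: finite_induct)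
  case empty
  then show ?case by (simp add: product_mset_def)
next
  case (insert i I)
  have "insert i I \<times> J = Pair i ` J \<union> I \<times> J" by auto
  moreover have "Pair i ` J \<inter> I \<times> J = {}" using insert.hyps by auto
  ultimately have "mset_set (insert i I \<times> J) = mset_set (Pair i ` J) + mset_set (I \<times> J)"
    using assms(2) insert.hyps by (simp add: mset_set_Union)
  also have "mset_set (Pair i ` J) = image_mset (Pair i) (mset_set J)"
    by (rule image_mset_mset_set[symmetric]) (simp add: inj_on_def)
  finally show ?case
    using insert by (simp add: product_mset_def multiset.map_comp comp_def)
qed

text \<open>The largest product is the product of the largest elements. If \<open>D\<close> were
  nonempty, so would be \<open>D'\<close>; cancelling the positive maximum of \<open>A\<close> would
  give them a common maximum, against disjointness.\<close>

lemma product_mset_cancel_disjoint: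
  assumes A: "A \<noteq> {#}" "\<And>a. a \<in># A \<Longrightarrow> a > 0"
    and eq: "product_mset A D = product_mset A D'" and disj: "set_mset D \<inter> set_mset D' = {}"
  shows "D = {#}"
proof (rule ccontr)
  assume D: "D \<noteq> {#}"
  define M where "M = Max (set_mset A)"
  have M: "M \<in># A" "\<And>a. a \<in># A \<Longrightarrow> a \<le> M" using A(1) by (auto simp: M_def)
  have M0: "M > 0" using A(2) M(1) by blast
  have sets: "{a * b | a b. a \<in># A \<and> b \<in># D} = {a * b | a b. a \<in># A \<and> b \<in># D'}"
    using arg_cong[OF eq, of set_mset] by (simp add: set_product_mset)
  have D': "D' \<noteq> {#}"
  proof
    assume "D' = {#}"
    moreover obtain b where "b \<in># D" using D by blast
    ultimately show False using sets M(1) by auto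
  qed
  have le: "Max (set_mset B) \<le> Max (set_mset B')"
    if "{a * b | a b. a \<in># A \<and> b \<in># B} \<subseteq> {a * b | a b. a \<in># A \<and> b \<in># B'}" "B \<noteq> {#}" for B B'
  proof -
    have "Max (set_mset B) \<in># B" using that(2) by simp
    then have "M * Max (set_mset B) \<in> {a * b | a b. a \<in># A \<and> b \<in># B'}" using that(1) M(1) by blast
    then obtain a b where ab: "a \<in># A" "b \<in># B'" "M * Max (set_mset B) = a * b" by blast
    have "a * b \<le> M * Max (set_mset B')" using ab(1,2) M(2) by (intro mult_le_mono) auto
    then have "M * Max (set_mset B) \<le> M * Max (set_mset B')" by (simp only: ab(3))
    then show ?thesis using M0 by simp
  qed
  have "Max (set_mset D) = Max (set_mset D')"
    using le[of D D'] le[of D' D] sets D D' by (intro antisym) auto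
  moreover have "Max (set_mset D) \<in> set_mset D" "Max (set_mset D') \<in> set_mset D'" using D D' by auto
  ultimately show False using disj by auto
qed

text \<open>Products distribute over multiset sums, so the common part \<open>C\<close> can be
  removed from both sides; the remainders are disjoint, hence empty.\<close>

lemma product_mset_cancel:
  assumes A: "A \<noteq> {#}" "\<And>a. a \<in># A \<Longrightarrow> a > 0" and eq: "product_mset A B = product_mset A B'"
  shows "B = B'"
proof -
  define C where "C = B \<inter># B'"
  have B: "B = C + (B - C)" and B': "B' = C + (B' - C)" by (auto simp: C_def multiset_eq_iff)
  have "product_mset A C + product_mset A (B - C) = product_mset A C + product_mset A (B' - C)"
    using eq B B' by (metis product_mset_add)
  then have eq': "product_mset A (B - C) = product_mset A (B' - C)" by simp
  have disj: "set_mset (B - C) \<inter> set_mset (B' - C) = {}"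
  proof (rule ccontr)
    assume "\<not> ?thesis"
    then obtain x where "x \<in># B - C" "x \<in># B' - C" by blast
    then have "count (B - C) x > 0" "count (B' - C) x > 0" by (simp_all only: count_greater_zero_iff)
    then show False by (simp add: C_def)
  qed
  have "B - C = {#}" "B' - C = {#}"
    using product_mset_cancel_disjoint[OF A eq' disj] product_mset_cancel_disjoint[OF A eq'[symmetric]] disj
    by (auto simp: Int_commute)
  then show ?thesis using B B' by simp
qed

lemma image_mset_eq_imp_bij:
  fixes m m' :: nat
  assumes "image_mset e (mset_set {..<m}) = image_mset e' (mset_set {..<m'})"
  obtains p where "bij_betw p {..<m} {..<m'}" "\<And>i. i < m \<Longrightarrow> e i = e' (p i)"
proof -
  have "mset (map e [0..<m]) = mset (map e' [0..<m'])"
    using assms by (simp add: atLeast0LessThan)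
  from permutation_Ex_bij[OF this] obtain p where
    p: "bij_betw p {..<m} {..<m'}" "\<forall>i<m. map e [0..<m] ! i = map e' [0..<m'] ! (p i)" by auto
  have "e i = e' (p i)" if "i < m" for i
    using p(2) that bij_betwE[OF p(1)] by auto
  with p(1) show ?thesis by (rule that)
qed

section \<open>Transformation matrices\<close>

lemma sum_factorizations:
  fixes G (structure)
  assumes grp: "group G" and c: "c \<in> carrier G"
  shows "(\<Sum>(x, y)\<in>{(x, y). x \<in> carrier G \<and> y \<in> carrier G \<and> x \<otimes> y = c}. f x * g y)
    = (\<Sum>x\<in>carrier G. f x * g (inv x \<otimes> c))"
proof -
  interpret group G by fact
  show ?thesis
    by (rule sum.reindex_bij_witness[where i = "\<lambda>x. (x, inv\<^bsub>G\<^esub> x \<otimes>\<^bsub>G\<^esub> c)" and j = fst])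
      (use c in \<open>auto simp flip: m_assoc\<close>)
qed

text \<open>Solving x y = c for y turns condition (3) into a convolution over one variable, which is
  easier to reindex and interchange.\<close>

lemma transformation_matrix_iff:
  assumes "group G'"
  shows "transformation_matrix G G' U \<longleftrightarrow>
     unitary_on (carrier G) (carrier G') U \<and>
     (\<forall>a\<in>carrier G. \<forall>b\<in>carrier G'. cnj (U a b) = U (inv\<^bsub>G\<^esub> a) (inv\<^bsub>G'\<^esub> b)) \<and>
     (\<forall>a\<in>carrier G. \<forall>b\<in>carrier G. \<forall>c\<in>carrier G'.
        U (a \<otimes>\<^bsub>G\<^esub> b) c = (\<Sum>x\<in>carrier G'. U a x * U b (inv\<^bsub>G'\<^esub> x \<otimes>\<^bsub>G'\<^esub> c)))"
  unfolding transformation_matrix_def by (simp add: sum_factorizations[OF assms] cong: conj_cong ball_cong)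

lemma orthonormal_on_combination:
  assumes "finite Y" "orthonormal_on S Y u"
  shows "inner_on S (\<lambda>a. \<Sum>k\<in>Y. c k * u k a) (\<lambda>a. \<Sum>k\<in>Y. c' k * u k a) = (\<Sum>k\<in>Y. c k * cnj (c' k))"
proof -
  have "inner_on S (\<lambda>a. \<Sum>k\<in>Y. c k * u k a) (\<lambda>a. \<Sum>k\<in>Y. c' k * u k a)
    = (\<Sum>k\<in>Y. c k * (\<Sum>l\<in>Y. cnj (c' l) * inner_on S (u k) (u l)))"
    by (simp add: inner_on_sum_left inner_on_sum_right)
  also have "\<dots> = (\<Sum>k\<in>Y. c k * (\<Sum>l\<in>Y. if k = l then cnj (c' l) else 0))"
    using assms(2) by (intro sum.cong refl arg_cong2[where f = "(*)"]) (auto simp: orthonormal_on_def)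
  also have "\<dots> = (\<Sum>k\<in>Y. c k * cnj (c' k))" using assms(1) by simp
  finally show ?thesis .
qed

text \<open>By Parseval in the basis \<open>v\<close>, the inner products of the rows are the
  entries of the projection kernel of \<open>u\<close>, which is the identity by completeness; the
  columns follow with the roles exchanged.\<close>

lemma unitary_on_change_of_basis:
  assumes fin: "finite S" "finite S'" "finite Y"
    and u: "orthonormal_on S Y u" "card Y = card S" and v: "orthonormal_on S' Y v" "card Y = card S'"
  shows "unitary_on S S' (\<lambda>a x. \<Sum>k\<in>Y. u k a * cnj (v k x))"
  unfolding unitary_on_def
proof (intro conjI ballI)
  fix a b assume ab: "a \<in> S" "b \<in> S"
  have "(\<Sum>x\<in>S'. (\<Sum>k\<in>Y. u k a * cnj (v k x)) * cnj (\<Sum>k\<in>Y. u k b * cnj (v k x)))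
    = inner_on S' (\<lambda>x. \<Sum>k\<in>Y. cnj (u k b) * v k x) (\<lambda>x. \<Sum>k\<in>Y. cnj (u k a) * v k x)"
    by (simp add: inner_on_def mult_ac)
  also have "\<dots> = projection_kernel Y u a b"
    unfolding orthonormal_on_combination[OF fin(3) v(1)] projection_kernel_def by (simp add: mult.commute)
  finally show "(\<Sum>x\<in>S'. (\<Sum>k\<in>Y. u k a * cnj (v k x)) * cnj (\<Sum>k\<in>Y. u k b * cnj (v k x))) = (if a = b then 1 else 0)"
    using orthonormal_on_complete[OF fin(1,3) u ab] by simp
next
  fix x y assume xy: "x \<in> S'" "y \<in> S'"
  have "(\<Sum>a\<in>S. cnj (\<Sum>k\<in>Y. u k a * cnj (v k x)) * (\<Sum>k\<in>Y. u k a * cnj (v k y)))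
    = inner_on S (\<lambda>a. \<Sum>k\<in>Y. cnj (v k y) * u k a) (\<lambda>a. \<Sum>k\<in>Y. cnj (v k x) * u k a)"
    by (simp add: inner_on_def mult_ac)
  also have "\<dots> = projection_kernel Y v x y"
    unfolding orthonormal_on_combination[OF fin(3) u(1)] projection_kernel_def by (simp add: mult.commute)
  finally show "(\<Sum>a\<in>S. cnj (\<Sum>k\<in>Y. u k a * cnj (v k x)) * (\<Sum>k\<in>Y. u k a * cnj (v k y))) = (if x = y then 1 else 0)"
    using orthonormal_on_complete[OF fin(2,3) v xy] by simp
qed

text \<open>Both systems share \<open>I\<close> and \<open>S\<close>, so their orthonormal
  coefficients correspond one to one and both groups have the same order. Collecting terms, V(a, x)
  is the average of d_i tr(r_i(a) r'_i(x)^-1): Fourier inversion on G' applied to the matrices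
  r_i(a). Multiplicativity of the r_i thus becomes convolution of rows.\<close>

lemma ex_transformation_matrix:
  assumes grp: "group G" "group G'" and fin: "finite (carrier G)" "finite (carrier G')"
    and complete: "complete_system G I S r" "complete_system G' I S r'"
  obtains V where "transformation_matrix G G' V"
    "\<And>x. x \<in> carrier G' \<Longrightarrow> V \<one>\<^bsub>G\<^esub> x = (if x = \<one>\<^bsub>G'\<^esub> then 1 else 0)"
proof -
  interpret G: group G by fact
  interpret G': group G' by fact
  have sys: "orthogonal_system G I S r" and sys': "orthogonal_system G' I S r'"
    using complete by (auto simp: complete_system_def)
  note rep = orthogonal_systemD(3)[OF sys] and rep' = orthogonal_systemD(3)[OF sys']
  define Y where "Y = coefficient_index I S"
  define u where "u = coefficient_family G S r"
  define v where "v = coefficient_family G' S r'"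
  have Y: "finite Y" unfolding Y_def by (rule finite_coefficient_index[OF sys])
  have u: "orthonormal_on (carrier G) Y u" and v: "orthonormal_on (carrier G') Y v"
    unfolding Y_def u_def v_def using orthonormal_coefficient_family grp fin sys sys' by blast+
  have cu: "card Y = card (carrier G)" and cv: "card Y = card (carrier G')"
    using complete card_coefficient_index[OF sys] by (simp_all add: Y_def complete_system_def)
  let ?N = "card (carrier G)"
  have N: "?N > 0" using fin(1) G.one_closed by (auto simp: card_gt_0_iff)
  define z where "z = (\<lambda>i. complex_of_nat (card (S i)) / of_nat ?N)"
  have z0: "z i \<noteq> 0" and zr: "cnj (z i) = z i" if "i \<in> I" for i
    using orthogonal_systemD(5)[OF sys that] N by (auto simp: z_def)
  have zz: "complex_of_real (sqrt (real (card (S i)) / ?N)) * complex_of_real (sqrt (real (card (S i)) / ?N)) = z i" for i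
    by (simp add: z_def flip: of_real_mult)
  have sqrt0: "complex_of_real (sqrt (real (card (S i)) / ?N)) \<noteq> 0" if "i \<in> I" for i
    using orthogonal_systemD(5)[OF sys that] N by simp
  define V where "V = (\<lambda>a x. \<Sum>k\<in>Y. u k a * cnj (v k x))"
  have V: "V a x = (\<Sum>i\<in>I. \<Sum>p\<in>S i. \<Sum>q\<in>S i. z i * (r i a p q * cnj (r' i x p q)))" for a x
  proof -
    have "V a x = (\<Sum>i\<in>I. \<Sum>(p, q)\<in>S i \<times> S i. u (i, p, q) a * cnj (v (i, p, q) x))"
      unfolding V_def Y_def coefficient_index_def
      using orthogonal_systemD(1,4)[OF sys] by (subst sum.Sigma) (auto simp: split_beta)
    also have "\<dots> = (\<Sum>i\<in>I. \<Sum>(p, q)\<in>S i \<times> S i. z i * (r i a p q * cnj (r' i x p q)))"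
      by (intro sum.cong refl) (auto simp: u_def v_def coefficient_family_def zz[symmetric] cu[symmetric] cv mult_ac)
    finally show ?thesis by (simp add: sum.cartesian_product)
  qed
  have "unitary_on (carrier G) (carrier G') V"
    unfolding V_def by (rule unitary_on_change_of_basis[OF fin Y u cu v cv])
  \<comment> \<open>Inversion conjugates and transposes both matrices; the two transpositions cancel
    on exchanging \<open>p\<close> and \<open>q\<close>.\<close>
  moreover have "cnj (V a x) = V (inv\<^bsub>G\<^esub> a) (inv\<^bsub>G'\<^esub> x)" if ax: "a \<in> carrier G" "x \<in> carrier G'" for a x
  proof -
    have "V (inv\<^bsub>G\<^esub> a) (inv\<^bsub>G'\<^esub> x) = (\<Sum>i\<in>I. \<Sum>p\<in>S i. \<Sum>q\<in>S i. z i * (cnj (r i a q p) * r' i x q p))"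
      unfolding V using unitary_repD(4)[OF rep ax(1)] unitary_repD(4)[OF rep' ax(2)]
      by (intro sum.cong refl) simp
    also have "\<dots> = (\<Sum>i\<in>I. \<Sum>q\<in>S i. \<Sum>p\<in>S i. z i * (cnj (r i a q p) * r' i x q p))"
      by (intro sum.cong refl sum.swap)
    also have "\<dots> = cnj (V a x)"
      unfolding V cnj_sum by (intro sum.cong refl) (simp add: zr)
    finally show ?thesis ..
  qed
  moreover have "V (a \<otimes>\<^bsub>G\<^esub> b) c = (\<Sum>x\<in>carrier G'. V a x * V b (inv\<^bsub>G'\<^esub> x \<otimes>\<^bsub>G'\<^esub> c))"
    if abc: "a \<in> carrier G" "b \<in> carrier G" "c \<in> carrier G'" for a b c
  proof -
    \<comment> \<open>Row \<open>a\<close> of \<open>V\<close> is an element of the group algebra of \<open>G'\<close> on which \<open>r' i\<close> takes the value \<open>r i a\<close>.\<close>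
    have image: "(\<Sum>x\<in>carrier G'. V a x * r' i x s p) = r i a s p" if i: "i \<in> I" and sp: "s \<in> S i" "p \<in> S i" for i s p
    proof -
      let ?w = "complex_of_real (sqrt (real (card (S i)) / ?N))"
      have k0: "(i, s, p) \<in> Y" using i sp by (simp add: Y_def coefficient_index_def)
      have "?w * (\<Sum>x\<in>carrier G'. V a x * r' i x s p) = inner_on (carrier G') (v (i, s, p)) (\<lambda>x. \<Sum>k\<in>Y. cnj (u k a) * v k x)"
        unfolding V_def inner_on_def cnj_sum
        by (simp add: v_def coefficient_family_def cu[symmetric] cv sum_distrib_left mult_ac)
      also have "\<dots> = (\<Sum>k\<in>Y. u k a * inner_on (carrier G') (v (i, s, p)) (v k))"
        by (simp add: inner_on_sum_right)
      also have "\<dots> = (\<Sum>k\<in>Y. if (i, s, p) = k then u k a else 0)"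
        using v k0 by (intro sum.cong refl) (auto simp: orthonormal_on_def)
      also have "\<dots> = u (i, s, p) a" using Y k0 by simp
      also have "\<dots> = ?w * r i a s p" by (simp add: u_def coefficient_family_def)
      finally show ?thesis using sqrt0[OF i] by (simp only: mult_left_cancel not_False_eq_True)
    qed
    \<comment> \<open>Unitarity moves the inverse off \<open>x\<close>, so that the only dependence
      on \<open>x\<close> is a factor \<open>r' i x s p\<close>, which \<open>image\<close> can sum
      against row \<open>a\<close>.\<close>
    have shift: "cnj (r' i (inv\<^bsub>G'\<^esub> x \<otimes>\<^bsub>G'\<^esub> c) p q) = (\<Sum>s\<in>S i. r' i x s p * cnj (r' i c s q))"
      if "i \<in> I" "p \<in> S i" "q \<in> S i" "x \<in> carrier G'" for i p q x
      using unitary_repD(2)[OF rep' G'.inv_closed[OF that(4)] abc(3) that(2,3)]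
        unitary_repD(4)[OF rep' that(4)] that by simp
    have "(\<Sum>x\<in>carrier G'. V a x * V b (inv\<^bsub>G'\<^esub> x \<otimes>\<^bsub>G'\<^esub> c))
      = (\<Sum>x\<in>carrier G'. \<Sum>i\<in>I. \<Sum>p\<in>S i. \<Sum>q\<in>S i. \<Sum>s\<in>S i. (V a x * r' i x s p) * (z i * r i b p q * cnj (r' i c s q)))"
      unfolding V[of b] sum_distrib_left
      by (intro sum.cong refl) (simp add: shift sum_distrib_left mult_ac)
    also have "\<dots> = (\<Sum>i\<in>I. \<Sum>p\<in>S i. \<Sum>q\<in>S i. \<Sum>s\<in>S i. (\<Sum>x\<in>carrier G'. V a x * r' i x s p) * (z i * r i b p q * cnj (r' i c s q)))"
      unfolding sum_distrib_right
      apply (subst sum.swap, intro sum.cong refl)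
      apply (subst sum.swap, intro sum.cong refl)
      apply (subst sum.swap, intro sum.cong refl)
      apply (rule sum.swap)
      done
    also have "\<dots> = (\<Sum>i\<in>I. \<Sum>p\<in>S i. \<Sum>q\<in>S i. \<Sum>s\<in>S i. r i a s p * (z i * r i b p q * cnj (r' i c s q)))"
      by (intro sum.cong refl) (simp add: image)
    also have "\<dots> = (\<Sum>i\<in>I. \<Sum>s\<in>S i. \<Sum>q\<in>S i. \<Sum>p\<in>S i. r i a s p * (z i * r i b p q * cnj (r' i c s q)))"
    proof (rule sum.cong[OF refl])
      fix i
      let ?f = "\<lambda>p q s. r i a s p * (z i * r i b p q * cnj (r' i c s q))"
      have "(\<Sum>p\<in>S i. \<Sum>q\<in>S i. \<Sum>s\<in>S i. ?f p q s) = (\<Sum>p\<in>S i. \<Sum>s\<in>S i. \<Sum>q\<in>S i. ?f p q s)"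
        by (intro sum.cong refl sum.swap)
      also have "\<dots> = (\<Sum>s\<in>S i. \<Sum>p\<in>S i. \<Sum>q\<in>S i. ?f p q s)" by (rule sum.swap)
      also have "\<dots> = (\<Sum>s\<in>S i. \<Sum>q\<in>S i. \<Sum>p\<in>S i. ?f p q s)"
        by (intro sum.cong refl sum.swap)
      finally show "(\<Sum>p\<in>S i. \<Sum>q\<in>S i. \<Sum>s\<in>S i. ?f p q s) = (\<Sum>s\<in>S i. \<Sum>q\<in>S i. \<Sum>p\<in>S i. ?f p q s)" .
    qed
    also have "\<dots> = V (a \<otimes>\<^bsub>G\<^esub> b) c"
      unfolding V using unitary_repD(2)[OF rep abc(1,2)]
      by (intro sum.cong refl) (simp add: sum_distrib_left sum_distrib_right mult_ac)
    finally show ?thesis ..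
  qed
  ultimately have "transformation_matrix G G' V" by (simp add: transformation_matrix_iff[OF grp(2)])
  moreover have "V \<one>\<^bsub>G\<^esub> x = (if x = \<one>\<^bsub>G'\<^esub> then 1 else 0)" if x: "x \<in> carrier G'" for x
  proof -
    \<comment> \<open>At the identity both are the same normalising constant times a Kronecker
      delta, the group orders being equal. Row 1 is thus a row of the kernel of \<open>v\<close>, a
      delta by completeness.\<close>
    have "u k \<one>\<^bsub>G\<^esub> = v k \<one>\<^bsub>G'\<^esub>" if "k \<in> Y" for k
      using that unitary_repD(3)[OF rep] unitary_repD(3)[OF rep']
      by (auto simp: u_def v_def coefficient_family_def Y_def coefficient_index_def cu[symmetric] cv[symmetric]
          simp flip: cu[unfolded Y_def coefficient_index_def] cv[unfolded Y_def coefficient_index_def])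
    then have "V \<one>\<^bsub>G\<^esub> x = projection_kernel Y v \<one>\<^bsub>G'\<^esub> x" by (simp add: V_def projection_kernel_def)
    then show ?thesis using orthonormal_on_complete[OF fin(2) Y v cv G'.one_closed x] by auto
  qed
  ultimately show ?thesis by (rule that)
qed

lemma transformation_matrix_iso:
  assumes grp: "group G" "group G1" "group G'" "group G1'"
    and f: "f \<in> iso G G1" and f': "f' \<in> iso G' G1'" and tm: "transformation_matrix G1 G1' U"
  shows "transformation_matrix G G' (\<lambda>a x. U (f a) (f' x))"
proof -
  interpret f: group_hom G G1 f using f grp by (auto simp: group_hom_def group_hom_axioms_def iso_def)
  interpret f': group_hom G' G1' f' using f' grp by (auto simp: group_hom_def group_hom_axioms_def iso_def)
  have bij: "bij_betw f (carrier G) (carrier G1)" and bij': "bij_betw f' (carrier G') (carrier G1')"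
    using f f' by (auto simp: iso_def)
  have inj: "f a = f b \<longleftrightarrow> a = b" if "a \<in> carrier G" "b \<in> carrier G" for a b
    using bij that by (auto simp: bij_betw_def dest: inj_onD)
  have inj': "f' a = f' b \<longleftrightarrow> a = b" if "a \<in> carrier G'" "b \<in> carrier G'" for a b
    using bij' that by (auto simp: bij_betw_def dest: inj_onD)
  have sum: "(\<Sum>a\<in>carrier G. h (f a)) = (\<Sum>a\<in>carrier G1. h a)" for h :: "_ \<Rightarrow> complex"
    by (rule sum.reindex_bij_betw[OF bij])
  have sum': "(\<Sum>a\<in>carrier G'. h (f' a)) = (\<Sum>a\<in>carrier G1'. h a)" for h :: "_ \<Rightarrow> complex"
    by (rule sum.reindex_bij_betw[OF bij'])
  have un: "unitary_on (carrier G1) (carrier G1') U" using tm by (simp add: transformation_matrix_def)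
  note tm = tm[unfolded transformation_matrix_iff[OF grp(4)]]
  have "unitary_on (carrier G) (carrier G') (\<lambda>a x. U (f a) (f' x))"
    unfolding unitary_on_def
  proof (intro conjI ballI)
    fix a b assume "a \<in> carrier G" "b \<in> carrier G"
    then show "(\<Sum>x\<in>carrier G'. U (f a) (f' x) * cnj (U (f b) (f' x))) = (if a = b then 1 else 0)"
      using un sum'[of "\<lambda>x. U (f a) x * cnj (U (f b) x)"] inj by (simp add: unitary_on_def)
  next
    fix x y assume "x \<in> carrier G'" "y \<in> carrier G'"
    then show "(\<Sum>a\<in>carrier G. cnj (U (f a) (f' x)) * U (f a) (f' y)) = (if x = y then 1 else 0)"
      using un sum[of "\<lambda>a. cnj (U a (f' x)) * U a (f' y)"] inj' by (simp add: unitary_on_def)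
  qed
  moreover have "U (f (a \<otimes>\<^bsub>G\<^esub> b)) (f' c)
      = (\<Sum>x\<in>carrier G'. U (f a) (f' x) * U (f b) (f' (inv\<^bsub>G'\<^esub> x \<otimes>\<^bsub>G'\<^esub> c)))"
    if "a \<in> carrier G" "b \<in> carrier G" "c \<in> carrier G'" for a b c
    using tm sum'[of "\<lambda>x. U (f a) x * U (f b) (inv\<^bsub>G1'\<^esub> x \<otimes>\<^bsub>G1'\<^esub> f' c)"] that by simp
  ultimately show ?thesis
    using tm by (simp add: transformation_matrix_iff[OF grp(3)])
qed

lemma transformation_matrix_DirProd:
  assumes grp: "group H" "group K" "group H'" "group K'"
    and tm: "transformation_matrix H H' U" "transformation_matrix K K' V"
  shows "transformation_matrix (H \<times>\<times> K) (H' \<times>\<times> K') (\<lambda>(h, k) (x, y). U h x * V k y)"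
proof -
  note U = tm(1)[unfolded transformation_matrix_iff[OF grp(3)]]
    and V = tm(2)[unfolded transformation_matrix_iff[OF grp(4)]]
  have UV: "unitary_on (carrier H) (carrier H') U" "unitary_on (carrier K) (carrier K') V"
    using tm by (auto simp: transformation_matrix_def)
  have prod: "(\<Sum>(x, y)\<in>A \<times> B. f x * g y) = (\<Sum>x\<in>A. f x) * (\<Sum>y\<in>B. g y)"
    for A :: "'x set" and B :: "'y set" and f g :: "_ \<Rightarrow> complex"
    by (simp add: sum_product sum.cartesian_product)
  have unitary: "unitary_on (carrier (H \<times>\<times> K)) (carrier (H' \<times>\<times> K')) (\<lambda>(h, k) (x, y). U h x * V k y)"
    unfolding unitary_on_def
  proof (intro conjI ballI)
    fix a b assume "a \<in> carrier (H \<times>\<times> K)" "b \<in> carrier (H \<times>\<times> K)"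
    then obtain h k h' k' where *: "a = (h, k)" "b = (h', k')" "h \<in> carrier H" "k \<in> carrier K" "h' \<in> carrier H" "k' \<in> carrier K"
      by auto
    have "(\<Sum>z\<in>carrier (H' \<times>\<times> K'). (case z of (x, y) \<Rightarrow> U h x * V k y) * cnj (case z of (x, y) \<Rightarrow> U h' x * V k' y))
      = (\<Sum>(x, y)\<in>carrier H' \<times> carrier K'. (U h x * cnj (U h' x)) * (V k y * cnj (V k' y)))"
      by (intro sum.cong) (auto simp: mult_ac)
    then show "(\<Sum>x\<in>carrier (H' \<times>\<times> K'). (case a of (h, k) \<Rightarrow> \<lambda>(x, y). U h x * V k y) x *
        cnj ((case b of (h, k) \<Rightarrow> \<lambda>(x, y). U h x * V k y) x)) = (if a = b then 1 else 0)"
      using UV * unfolding unitary_on_def prod by simp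
  next
    fix a b assume "a \<in> carrier (H' \<times>\<times> K')" "b \<in> carrier (H' \<times>\<times> K')"
    then obtain x y x' y' where *: "a = (x, y)" "b = (x', y')" "x \<in> carrier H'" "y \<in> carrier K'" "x' \<in> carrier H'" "y' \<in> carrier K'"
      by auto
    have "(\<Sum>z\<in>carrier (H \<times>\<times> K). cnj ((case z of (h, k) \<Rightarrow> \<lambda>(x, y). U h x * V k y) (x, y)) *
        (case z of (h, k) \<Rightarrow> \<lambda>(x, y). U h x * V k y) (x', y'))
      = (\<Sum>(h, k)\<in>carrier H \<times> carrier K. (cnj (U h x) * U h x') * (cnj (V k y) * V k y'))"
      by (intro sum.cong) (auto simp: mult_ac)
    then show "(\<Sum>z\<in>carrier (H \<times>\<times> K). cnj ((case z of (h, k) \<Rightarrow> \<lambda>(x, y). U h x * V k y) a) *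
        (case z of (h, k) \<Rightarrow> \<lambda>(x, y). U h x * V k y) b) = (if a = b then 1 else 0)"
      using UV * unfolding unitary_on_def prod by simp
  qed
  have conv: "U (h \<otimes>\<^bsub>H\<^esub> h') c * V (k \<otimes>\<^bsub>K\<^esub> k') d = (\<Sum>z\<in>carrier H' \<times> carrier K'.
      (case z of (x, y) \<Rightarrow> U h x * V k y) *
      (case inv\<^bsub>H' \<times>\<times> K'\<^esub> z \<otimes>\<^bsub>H' \<times>\<times> K'\<^esub> (c, d) of (x, y) \<Rightarrow> U h' x * V k' y))"
    if "h \<in> carrier H" "h' \<in> carrier H" "k \<in> carrier K" "k' \<in> carrier K" "c \<in> carrier H'" "d \<in> carrier K'"
    for h h' k k' c d
  proof -
    have "U (h \<otimes>\<^bsub>H\<^esub> h') c * V (k \<otimes>\<^bsub>K\<^esub> k') d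
      = (\<Sum>x\<in>carrier H'. U h x * U h' (inv\<^bsub>H'\<^esub> x \<otimes>\<^bsub>H'\<^esub> c)) * (\<Sum>y\<in>carrier K'. V k y * V k' (inv\<^bsub>K'\<^esub> y \<otimes>\<^bsub>K'\<^esub> d))"
      using U V that by simp
    also have "\<dots> = (\<Sum>(x, y)\<in>carrier H' \<times> carrier K'. (U h x * U h' (inv\<^bsub>H'\<^esub> x \<otimes>\<^bsub>H'\<^esub> c)) * (V k y * V k' (inv\<^bsub>K'\<^esub> y \<otimes>\<^bsub>K'\<^esub> d)))"
      by (rule prod[symmetric])
    also have "\<dots> = (\<Sum>z\<in>carrier H' \<times> carrier K'. (case z of (x, y) \<Rightarrow> U h x * V k y) *
      (case inv\<^bsub>H' \<times>\<times> K'\<^esub> z \<otimes>\<^bsub>H' \<times>\<times> K'\<^esub> (c, d) of (x, y) \<Rightarrow> U h' x * V k' y))"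
      by (intro sum.cong refl) (auto simp: mult_ac inv_DirProd[OF grp(3,4)])
    finally show ?thesis .
  qed
  show ?thesis
    unfolding transformation_matrix_iff[OF DirProd_group[OF grp(3,4)]]
  proof (intro conjI ballI unitary)
    fix a b assume "a \<in> carrier (H \<times>\<times> K)" "b \<in> carrier (H' \<times>\<times> K')"
    then show "cnj ((case a of (h, k) \<Rightarrow> \<lambda>(x, y). U h x * V k y) b)
      = (case inv\<^bsub>H \<times>\<times> K\<^esub> a of (h, k) \<Rightarrow> \<lambda>(x, y). U h x * V k y) (inv\<^bsub>H' \<times>\<times> K'\<^esub> b)"
      using U V by (auto simp: inv_DirProd[OF grp(1,2)] inv_DirProd[OF grp(3,4)])
  next
    fix a b c assume "a \<in> carrier (H \<times>\<times> K)" "b \<in> carrier (H \<times>\<times> K)" "c \<in> carrier (H' \<times>\<times> K')"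
    then show "(case a \<otimes>\<^bsub>H \<times>\<times> K\<^esub> b of (h, k) \<Rightarrow> \<lambda>(x, y). U h x * V k y) c
      = (\<Sum>x\<in>carrier (H' \<times>\<times> K'). (case a of (h, k) \<Rightarrow> \<lambda>(x, y). U h x * V k y) x *
          (case b of (h, k) \<Rightarrow> \<lambda>(x, y). U h x * V k y) (inv\<^bsub>H' \<times>\<times> K'\<^esub> x \<otimes>\<^bsub>H' \<times>\<times> K'\<^esub> c))"
      using conv by (auto simp del: mult_DirProd' )
  qed
qed

section \<open>Linear characters and their monomial matrices\<close>

lemma linear_characterD:
  assumes "linear_character G \<chi>"
  shows "\<And>a. a \<in> carrier G \<Longrightarrow> \<chi> a \<noteq> 0"
    and "\<And>a b. a \<in> carrier G \<Longrightarrow> b \<in> carrier G \<Longrightarrow> \<chi> (a \<otimes>\<^bsub>G\<^esub> b) = \<chi> a * \<chi> b"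
  using assms by (auto simp: linear_character_def hom_def complex_mult_group_def)

lemma linear_character_one:
  assumes grp: "group G" and chi: "linear_character G \<chi>"
  shows "\<chi> \<one>\<^bsub>G\<^esub> = 1"
proof -
  interpret group G by fact
  show ?thesis using linear_characterD[OF chi, of "\<one>\<^bsub>G\<^esub>"] linear_characterD(2)[OF chi, of "\<one>\<^bsub>G\<^esub>" "\<one>\<^bsub>G\<^esub>"] by simp
qed

text \<open>Each value is a root of unity, since a to the power of the group order is the
  identity.\<close>

lemma linear_character_norm:
  assumes grp: "group G" and fin: "finite (carrier G)" and chi: "linear_character G \<chi>" and a: "a \<in> carrier G"
  shows "cmod (\<chi> a) = 1"
proof -
  interpret group G by fact
  have pow: "\<chi> (a [^]\<^bsub>G\<^esub> n) = \<chi> a ^ n" for n :: nat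
    by (induction n) (simp_all add: linear_character_one[OF grp chi] linear_characterD(2)[OF chi] a mult.commute)
  have "\<chi> a ^ Coset.order G = 1"
    using pow[of "Coset.order G"] pow_order_eq_1[OF a] linear_character_one[OF grp chi] by simp
  then have "cmod (\<chi> a) ^ Coset.order G = 1" by (metis norm_one norm_power)
  moreover have "Coset.order G > 0" using fin by (simp add: order_gt_0_iff_finite)
  ultimately show ?thesis
    using power_eq_imp_eq_base[of "cmod (\<chi> a)" "Coset.order G" 1] by simp
qed

text \<open>A permutation matrix twisted by \<chi>. Values of modulus one give unitarity and make
  \<chi> of an inverse the conjugate, which is condition (2).\<close>

lemma transformation_matrix_linear_character:
  assumes grp: "group G" "group G'" and fin: "finite (carrier G)"
    and f: "f \<in> iso G G'" and chi: "linear_character G \<chi>"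
  shows "transformation_matrix G G' (\<lambda>a x. if x = f a then \<chi> a else 0)"
proof -
  interpret f: group_hom G G' f using f grp by (auto simp: group_hom_def group_hom_axioms_def iso_def)
  have bij: "bij_betw f (carrier G) (carrier G')" using f by (simp add: iso_def)
  have fin': "finite (carrier G')" using bij_betw_finite[OF bij] fin by simp
  have inj: "f a = f b \<longleftrightarrow> a = b" if "a \<in> carrier G" "b \<in> carrier G" for a b
    using bij that by (auto simp: bij_betw_def dest: inj_onD)
  have norm: "\<chi> a * cnj (\<chi> a) = 1" if "a \<in> carrier G" for a
    using linear_character_norm[OF grp(1) fin chi that] by (simp flip: complex_norm_square)
  have inv: "\<chi> (inv\<^bsub>G\<^esub> a) = cnj (\<chi> a)" if "a \<in> carrier G" for a
  proof -
    have "\<chi> a * \<chi> (inv\<^bsub>G\<^esub> a) = \<chi> a * cnj (\<chi> a)"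
      using linear_characterD(2)[OF chi that group.inv_closed[OF grp(1) that]] linear_character_one[OF grp(1) chi] norm[OF that] that
      by simp
    then show ?thesis using linear_characterD(1)[OF chi that] by simp
  qed
  have "unitary_on (carrier G) (carrier G') (\<lambda>a x. if x = f a then \<chi> a else 0)"
    unfolding unitary_on_def
  proof (intro conjI ballI)
    fix a b assume ab: "a \<in> carrier G" "b \<in> carrier G"
    have "(\<Sum>x\<in>carrier G'. (if x = f a then \<chi> a else 0) * cnj (if x = f b then \<chi> b else 0))
      = (\<Sum>x\<in>carrier G'. if x = f a then if a = b then 1 else 0 else 0)"
      using norm ab inj by (intro sum.cong refl) auto
    then show "(\<Sum>x\<in>carrier G'. (if x = f a then \<chi> a else 0) * cnj (if x = f b then \<chi> b else 0)) = (if a = b then 1 else 0)"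
      using fin' ab by simp
  next
    fix x y assume "x \<in> carrier G'" "y \<in> carrier G'"
    then obtain a0 b0 where ab: "a0 \<in> carrier G" "b0 \<in> carrier G" "x = f a0" "y = f b0"
      using bij_betw_imp_surj_on[OF bij] by (metis imageE)
    have "(\<Sum>a\<in>carrier G. cnj (if x = f a then \<chi> a else 0) * (if y = f a then \<chi> a else 0))
      = (\<Sum>a\<in>carrier G. if a = a0 then if x = y then 1 else 0 else 0)"
      using norm ab inj by (intro sum.cong refl) (auto simp: mult.commute)
    then show "(\<Sum>a\<in>carrier G. cnj (if x = f a then \<chi> a else 0) * (if y = f a then \<chi> a else 0)) = (if x = y then 1 else 0)"
      using fin ab by simp
  qed
  moreover have "cnj (if x = f a then \<chi> a else 0) = (if inv\<^bsub>G'\<^esub> x = f (inv\<^bsub>G\<^esub> a) then \<chi> (inv\<^bsub>G\<^esub> a) else 0)"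
    if "a \<in> carrier G" "x \<in> carrier G'" for a x
    using that inv by auto
  moreover have "(if c = f (a \<otimes>\<^bsub>G\<^esub> b) then \<chi> (a \<otimes>\<^bsub>G\<^esub> b) else 0)
    = (\<Sum>x\<in>carrier G'. (if x = f a then \<chi> a else 0) * (if inv\<^bsub>G'\<^esub> x \<otimes>\<^bsub>G'\<^esub> c = f b then \<chi> b else 0))"
    if abc: "a \<in> carrier G" "b \<in> carrier G" "c \<in> carrier G'" for a b c
  proof -
    have "(\<Sum>x\<in>carrier G'. (if x = f a then \<chi> a else 0) * (if inv\<^bsub>G'\<^esub> x \<otimes>\<^bsub>G'\<^esub> c = f b then \<chi> b else 0))
      = (\<Sum>x\<in>carrier G'. if x = f a then \<chi> a * (if inv\<^bsub>G'\<^esub> (f a) \<otimes>\<^bsub>G'\<^esub> c = f b then \<chi> b else 0) else 0)"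
      by (intro sum.cong refl) auto
    also have "\<dots> = \<chi> a * (if inv\<^bsub>G'\<^esub> (f a) \<otimes>\<^bsub>G'\<^esub> c = f b then \<chi> b else 0)"
      using fin' abc by simp
    also have "inv\<^bsub>G'\<^esub> (f a) \<otimes>\<^bsub>G'\<^esub> c = f b \<longleftrightarrow> c = f (a \<otimes>\<^bsub>G\<^esub> b)"
      using abc f.H.inv_solve_left'[of "f b" "f a" c] by auto
    finally show ?thesis using linear_characterD(2)[OF chi] abc by simp
  qed
  ultimately show ?thesis by (simp add: transformation_matrix_iff[OF grp(2)])
qed

section \<open>Assembly along the internal direct products\<close>

lemma internal_direct_product_iso:
  fixes G (structure)
  assumes grp: "group G" and dp: "internal_direct_product G H K"
  shows "(\<lambda>(x, y). x \<otimes> y) \<in> iso (G\<lparr>carrier := H\<rparr> \<times>\<times> G\<lparr>carrier := K\<rparr>) G"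
proof -
  interpret group G by fact
  have n: "H \<lhd> G" "K \<lhd> G" and HK: "H <#> K = carrier G" "H \<inter> K \<subseteq> {\<one>}"
    using dp by (auto simp: internal_direct_product_def)
  have sub: "subgroup H G" "subgroup K G" using n by (auto simp: normal_def)
  have "subgroup_generated G A = G\<lparr>carrier := A\<rparr>" if "subgroup A G" for A
    using subgroup.carrier_subgroup_generated_subgroup[OF that] by (simp add: subgroup_generated_def)
  then show ?thesis
    using iso_group_mul_gen[OF n] HK sub by simp
qed


theorem theorem10p2:
  fixes G :: "('a, 'c) monoid_scheme" and G' :: "('b, 'd) monoid_scheme"
    and H K :: "'a set" and H' K' :: "'b set"
    and \<sigma> :: "'a \<Rightarrow> 'b"
  assumes "group G" and "finite (carrier G)"
    and "group G'" and "finite (carrier G')"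
    and "subgroup H G" and "subgroup K G"
    and "subgroup H' G'" and "subgroup K' G'"
    and "G\<lparr>carrier := H\<rparr> \<cong> G'\<lparr>carrier := H'\<rparr>"
    and "internal_direct_product G H K"
    and "internal_direct_product G' H' K'"
    and "irrep_degrees G = irrep_degrees G'"
    and "\<sigma> \<in> iso (G\<lparr>carrier := H\<rparr>) (G'\<lparr>carrier := H'\<rparr>)"
  shows "\<forall>\<chi>. linear_character (G\<lparr>carrier := H\<rparr>) \<chi> \<longrightarrow>
    (\<exists>U. transformation_matrix G G' U \<and>
      (\<forall>h\<in>H. \<forall>x\<in>carrier G'. U h x = (if x = \<sigma> h then \<chi> h else 0)))"
proof (intro allI impI)
  fix \<chi> assume chi: "linear_character (G\<lparr>carrier := H\<rparr>) \<chi>"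
  interpret G: group G by fact
  interpret G': group G' by fact
  let ?H = "G\<lparr>carrier := H\<rparr>" and ?K = "G\<lparr>carrier := K\<rparr>"
  let ?H' = "G'\<lparr>carrier := H'\<rparr>" and ?K' = "G'\<lparr>carrier := K'\<rparr>"
  have grp: "group ?H" "group ?K" "group ?H'" "group ?K'"
    using assms(5-8) by (auto intro: subgroup.subgroup_is_group assms(1,3))
  have fin: "finite H" "finite K" "finite H'" "finite K'"
    using assms(2,4,5-8) by (auto intro: finite_subset dest: subgroup.subset)
  \<comment> \<open>\<phi> and \<phi>' read off the two components of an element of the internal
    direct product.\<close>
  define \<phi> where "\<phi> = inv_into (carrier (?H \<times>\<times> ?K)) (\<lambda>(x, y). x \<otimes>\<^bsub>G\<^esub> y)"
  define \<phi>' where "\<phi>' = inv_into (carrier (?H' \<times>\<times> ?K')) (\<lambda>(x, y). x \<otimes>\<^bsub>G'\<^esub> y)"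
  have m: "(\<lambda>(x, y). x \<otimes>\<^bsub>G\<^esub> y) \<in> iso (?H \<times>\<times> ?K) G" and m': "(\<lambda>(x, y). x \<otimes>\<^bsub>G'\<^esub> y) \<in> iso (?H' \<times>\<times> ?K') G'"
    using assms(1,3,10,11) by (auto intro: internal_direct_product_iso)
  have phi: "\<phi> \<in> iso G (?H \<times>\<times> ?K)" and phi': "\<phi>' \<in> iso G' (?H' \<times>\<times> ?K')"
    unfolding \<phi>_def \<phi>'_def
    using group.iso_set_sym[OF DirProd_group[OF grp(1,2)] m] group.iso_set_sym[OF DirProd_group[OF grp(3,4)] m'] by auto
  obtain n :: nat and d :: "nat \<Rightarrow> nat" and r where H'_sys: "complete_system ?H' {..<n} (\<lambda>i. {..<d i}) r"
    using ex_complete_system[OF grp(3)] fin by auto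
  obtain l :: nat and e :: "nat \<Rightarrow> nat" and s where K_sys: "complete_system ?K {..<l} (\<lambda>i. {..<e i}) s"
    using ex_complete_system[OF grp(2)] fin by auto
  obtain l' :: nat and e' :: "nat \<Rightarrow> nat" and s' where K'_sys: "complete_system ?K' {..<l'} (\<lambda>i. {..<e' i}) s'"
    using ex_complete_system[OF grp(4)] fin by auto
  \<comment> \<open>The system of H is the one of H' pulled back along \<sigma>, so both degree
    multisets carry literally the same factor \<open>?D\<close>.\<close>
  have H_sys: "complete_system ?H {..<n} (\<lambda>i. {..<d i}) (\<lambda>i g. r i (\<sigma> g))"
    by (rule complete_system_iso[OF grp(3,1) assms(13) H'_sys])
  let ?D = "image_mset d (mset_set {..<n})"
  have degrees: "irrep_degrees G = product_mset ?D (image_mset e (mset_set {..<l}))"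
    using irrep_degrees_eq[OF assms(1,2) complete_system_iso[OF DirProd_group[OF grp(1,2)] assms(1) phi
          complete_system_DirProd[OF grp(1,2) H_sys K_sys]]]
    by (simp add: product_mset_index[symmetric] split_beta card_cartesian_product)
  have degrees': "irrep_degrees G' = product_mset ?D (image_mset e' (mset_set {..<l'}))"
    using irrep_degrees_eq[OF assms(3,4) complete_system_iso[OF DirProd_group[OF grp(3,4)] assms(3) phi'
          complete_system_DirProd[OF grp(3,4) H'_sys K'_sys]]]
    by (simp add: product_mset_index[symmetric] split_beta card_cartesian_product)
  \<comment> \<open>H' has at least one element, so its squared degrees do not add up to zero and
    \<open>?D\<close> is nonempty, as cancellation requires.\<close>
  have "\<one>\<^bsub>G'\<^esub> \<in> H'" using assms(7) by (rule subgroup.one_closed)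
  then have "(\<Sum>i<n. (card {..<d i})\<^sup>2) \<noteq> 0"
    using H'_sys fin(3) by (auto simp: complete_system_def)
  then have "?D \<noteq> {#}" by (auto simp: mset_set_empty_iff)
  moreover have "a > 0" if "a \<in># ?D" for a
    using that H'_sys orthogonal_systemD(5)[of ?H' "{..<n}" "\<lambda>i. {..<d i}" r] by (auto simp: complete_system_def)
  moreover have "product_mset ?D (image_mset e (mset_set {..<l})) = product_mset ?D (image_mset e' (mset_set {..<l'}))"
    using assms(12) degrees degrees' by simp
  ultimately have "image_mset e (mset_set {..<l}) = image_mset e' (mset_set {..<l'})"
    by (rule product_mset_cancel)
  then obtain p where p: "bij_betw p {..<l} {..<l'}" "\<And>i. i < l \<Longrightarrow> e i = e' (p i)"
    by (rule image_mset_eq_imp_bij) blast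
  have K'_sys': "complete_system ?K' {..<l} (\<lambda>i. {..<e' (p i)}) (\<lambda>i. s' (p i))"
    using complete_system_reindex[OF K'_sys p(1)] .
  \<comment> \<open>The index sets are rewritten through \<open>p\<close> so that the two systems
    agree in index sets, as the matching construction demands.\<close>
  have K_sys': "complete_system ?K {..<l} (\<lambda>i. {..<e' (p i)}) s"
    using K_sys p(2) by (simp add: complete_system_def orthogonal_system_def)
  have finK: "finite (carrier ?K)" "finite (carrier ?K')" using fin by simp_all
  obtain V where V: "transformation_matrix ?K ?K' V"
    and V1: "\<And>x. x \<in> carrier ?K' \<Longrightarrow> V \<one>\<^bsub>?K\<^esub> x = (if x = \<one>\<^bsub>?K'\<^esub> then 1 else 0)"
    using ex_transformation_matrix[OF grp(2,4) finK K_sys' K'_sys'] by blast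
  define W where "W = (\<lambda>(h, k) (x, y). (if x = \<sigma> h then \<chi> h else 0) * V k y)"
  have "transformation_matrix (?H \<times>\<times> ?K) (?H' \<times>\<times> ?K') W"
    unfolding W_def using fin
    by (intro transformation_matrix_DirProd transformation_matrix_linear_character grp V assms(13) chi) auto
  then have tm: "transformation_matrix G G' (\<lambda>a x. W (\<phi> a) (\<phi>' x))"
    by (intro transformation_matrix_iso[OF assms(1) DirProd_group[OF grp(1,2)] assms(3) DirProd_group[OF grp(3,4)]] phi phi')
  have phi_mult: "\<phi> (h \<otimes>\<^bsub>G\<^esub> k) = (h, k)" if "h \<in> H" "k \<in> K" for h k
  proof -
    have "inj_on (\<lambda>(x, y). x \<otimes>\<^bsub>G\<^esub> y) (carrier (?H \<times>\<times> ?K))" using m by (simp add: iso_def bij_betw_def)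
    from inv_into_f_f[OF this, of "(h, k)"] that show ?thesis by (simp add: \<phi>_def)
  qed
  have phi_mult': "\<phi>' (h \<otimes>\<^bsub>G'\<^esub> k) = (h, k)" if "h \<in> H'" "k \<in> K'" for h k
  proof -
    have "inj_on (\<lambda>(x, y). x \<otimes>\<^bsub>G'\<^esub> y) (carrier (?H' \<times>\<times> ?K'))" using m' by (simp add: iso_def bij_betw_def)
    from inv_into_f_f[OF this, of "(h, k)"] that show ?thesis by (simp add: \<phi>'_def)
  qed
  have one: "\<one>\<^bsub>G\<^esub> \<in> K" "\<one>\<^bsub>G'\<^esub> \<in> K'" using assms(6,8) by (auto intro: subgroup.one_closed)
  have "W (\<phi> h) (\<phi>' x) = (if x = \<sigma> h then \<chi> h else 0)" if h: "h \<in> H" and x: "x \<in> carrier G'" for h x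
  proof -
    have hG: "h \<in> carrier G" using h assms(5) by (rule subgroup.mem_carrier[rotated])
    have sh: "\<sigma> h \<in> H'" using assms(13) h by (auto simp: iso_def hom_def)
    then have shG: "\<sigma> h \<in> carrier G'" using assms(7) by (rule subgroup.mem_carrier[rotated])
    \<comment> \<open>Since h = h 1, the second component is the identity, so only the identity row
      of \<open>V\<close> contributes.\<close>
    have ph: "\<phi> h = (h, \<one>\<^bsub>G\<^esub>)" using phi_mult[OF h one(1)] hG by simp
    obtain y z where yz: "y \<in> H'" "z \<in> K'" "x = y \<otimes>\<^bsub>G'\<^esub> z"
      using x assms(11) unfolding internal_direct_product_def set_mult_def by blast
    have psh: "\<phi>' (\<sigma> h) = (\<sigma> h, \<one>\<^bsub>G'\<^esub>)" using phi_mult'[OF sh one(2)] shG by simp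
    \<comment> \<open>By uniqueness of components, the delta at \<sigma>(h) is the product of the
      delta for \<open>y\<close> in the monomial factor and the delta for \<open>z\<close> in the
      identity row of \<open>V\<close>.\<close>
    have "x = \<sigma> h \<longleftrightarrow> y = \<sigma> h \<and> z = \<one>\<^bsub>G'\<^esub>"
      using phi_mult'[OF yz(1,2)] psh yz(3) shG by auto
    then show ?thesis
      using V1[of z] yz(2) by (simp add: W_def ph yz(3) phi_mult'[OF yz(1,2)])
  qed
  with tm show "\<exists>U. transformation_matrix G G' U \<and>
      (\<forall>h\<in>H. \<forall>x\<in>carrier G'. U h x = (if x = \<sigma> h then \<chi> h else 0))" by blast
qed

end
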